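(* Let $p\ge 0$ be an integer, let $f:\mathbb{R}\to\mathbb{R}$ be smooth, and let $\mathcal{M}_{2p+6,f}=(\mathbb{R}^{2p+6},g_{2p+6,f})$ be the pseudo-Riemannian manifold defined in the context. Then: 1. All geodesics in $\mathcal{M}_{2p+6,f}$ extend for infinite time (i.e. are defined on all of $\mathbb{R}$). 2. For every $P\in\mathbb{R}^{2p+6}$, the exponential map $\exp_P:T_P\mathbb{R}^{2p+6}\to\mathbb{R}^{2p+6}$ is a diffeomorphism. 3. $\mathcal{U}_{2p+6}^{p}$ is a $p$-model for $\mathcal{M}_{2p+6,f}$. 4. If $f^{(p+3)}>0$ and $f^{(p+4)}>0$ on $\mathbb{R}$, then $\mathcal{U}_{2p+6}^{p+2}$ is a $(p+2)$-model for $\mathcal{M}_{2p+6,f}$.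
   Context: Manifold. Let $(x,y,z_0,\dots,z_p,\bar x,\bar y,\bar z_0,\dots,\bar z_p)$ be coordinates on $\mathbb{R}^{2p+6}$. For smooth $f=f(y)$ put $F_{2p+6,f}(y,\vec z)=f(y)+yz_0+y^2z_1+\dots+y^{p+1}z_p$. The metric $g_{2p+6,f}$, of neutral signature $(p+3,p+3)$, is the symmetric tensor whose only non-zero components (up to symmetry) are $g(\partial_{z_i},\partial_{\bar z_j})=\delta_{ij}$, $g(\partial_x,\partial_{\bar x})=1$, $g(\partial_y,\partial_{\bar y})=1$, $g(\partial_x,\partial_x)=-2F_{2p+6,f}(y,\vec z)$. Curvature. $\nabla$ is the Levi-Civita connection, $\mathcal{R}(\xi_1,\xi_2)=\nabla_{\xi_1}\nabla_{\xi_2}-\nabla_{\xi_2}\nabla_{\xi_1}-\nabla_{[\xi_1,\xi_2]}$, $R(\xi_1,\xi_2,\xi_3,\xi_4)=g(\mathcal{R}(\xi_1,\xi_2)\xi_3,\xi_4)$, and $\nabla^kR(\xi_1,\xi_2,\xi_3,\xi_4;\eta_1,\dots,\eta_k)$ is the $k$-th covariant derivative, with the differentiation slots written after the semicolon. Models. A $k$-model is a tuple $(V,g,A^0,\dots,A^k)$ where $V$ is a real vector space of finite dimension $m$, $g$ is a (non-degenerate, possibly indefinite) inner product on $V$ and $A^i\in\otimes^{4+i}V^*$. It is a $k$-model for a pseudo-Riemannian manifold $(M,g_M)$ if for every $P\in M$ there is a linear isomorphism $\phi_P:T_PM\to V$ with $\phi_P^*g=(g_M)_P$ and $\phi_P^*A^i=\nabla^iR_P$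 for $0\le i\le k$. The models $\mathcal{U}_{2p+6}^i$. Fix a basis $\{X,Y,Z_0,\dots,Z_p,\bar X,\bar Y,\bar Z_0,\dots,\bar Z_p\}$ of $\mathbb{R}^{2p+6}$. For $0\le i\le p+2$, $\mathcal{U}_{2p+6}^i=(\mathbb{R}^{2p+6},g_{2p+6},A^0_{2p+6},\dots,A^i_{2p+6})$, where the only non-zero components, up to the usual $\mathbb{Z}_2$ symmetries (symmetry of $g$; and, in the first four slots of each $A^k$, the symmetries $A(\xi_1,\xi_2,\xi_3,\xi_4;\cdot)=-A(\xi_2,\xi_1,\xi_3,\xi_4;\cdot)=A(\xi_3,\xi_4,\xi_1,\xi_2;\cdot)$), are: - $g_{2p+6}(X,\bar X)=g_{2p+6}(Y,\bar Y)=g_{2p+6}(Z_j,\bar Z_j)=1$ for $0\le j\le p$; - $A^0_{2p+6}(X,Y,Z_0,X)=1$; - for $1\le k\le p$: $A^k_{2p+6}(X,Y,Z_k,X;Y,\dots,Y)=1$, and $A^k_{2p+6}(X,Y,Y,X;Y,\dots,Y,Z_k,Y,\dots,Y)=1$ for each of the $k$ possible positions of $Z_k$ after the semicolon (the other $k-1$ entries being $Y$); - $A^{p+1}_{2p+6}(X,Y,Y,X;Y,\dots,Y)=1$ and $A^{p+2}_{2p+6}(X,Y,Y,X;Y,\dots,Y)=1$. *)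

theory Defs
  imports "HOL-Analysis.Analysis"
begin

section \<open>Smooth maps between normed spaces\<close>

primrec times_differentiable ::
    "nat \<Rightarrow> ('a::euclidean_space \<Rightarrow> 'b::real_normed_vector) \<Rightarrow> bool" where
  "times_differentiable 0 f \<longleftrightarrow> continuous_on UNIV f"
| "times_differentiable (Suc k) f \<longleftrightarrow>
     (\<forall>x. f differentiable (at x)) \<and>
     (\<forall>v. times_differentiable k (\<lambda>x. frechet_derivative f (at x) v))"

definition smooth_map :: "('a::euclidean_space \<Rightarrow> 'b::real_normed_vector) \<Rightarrow> bool" where
  "smooth_map f \<longleftrightarrow> (\<forall>k. times_differentiable k f)"

definition diffeomorphism :: "('a::euclidean_space \<Rightarrow> 'b::euclidean_space) \<Rightarrow> bool" where
  "diffeomorphism f \<longleftrightarrow> bij f \<and> smooth_map f \<and> smooth_map (inv f)"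

section \<open>Pseudo-Riemannian metrics on a coordinate space\<close>

text \<open>
  The manifold is \<open>real ^ 'n\<close> with its global chart. Each tangent space is identified with
  \<open>real ^ 'n\<close>, the coordinate fields being the constant fields \<open>axis i 1\<close>. A metric assigns to
  each point a bilinear form.
\<close>

definition inner_product_form :: "('v::real_vector \<Rightarrow> 'v \<Rightarrow> real) \<Rightarrow> bool" where
  "inner_product_form b \<longleftrightarrow>
     (\<forall>u. linear (b u)) \<and> (\<forall>u v. b u v = b v u) \<and> (\<forall>u. (\<forall>v. b u v = 0) \<longrightarrow> u = 0)"

definition pseudo_riemannian :: "(real^'n \<Rightarrow> real^'n \<Rightarrow> real^'n \<Rightarrow> real) \<Rightarrow> bool" where
  "pseudo_riemannian g \<longleftrightarrow>
     (\<forall>P. inner_product_form (g P)) \<and> (\<forall>u v. smooth_map (\<lambda>P. g P u v))"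

text \<open>
  \<open>christoffel g P u v\<close> is the value at \<open>P\<close> of the Levi-Civita derivative of the constant field
  \<open>v\<close> in the direction \<open>u\<close>. It is given by the Koszul formula, whose bracket terms vanish for
  constant fields.
\<close>

definition christoffel ::
    "(real^'n \<Rightarrow> real^'n \<Rightarrow> real^'n \<Rightarrow> real) \<Rightarrow> real^'n \<Rightarrow> real^'n \<Rightarrow> real^'n \<Rightarrow> real^'n" where
  "christoffel g P u v = (THE w. \<forall>e. 2 * g P w e =
       frechet_derivative (\<lambda>Q. g Q v e) (at P) u
     + frechet_derivative (\<lambda>Q. g Q u e) (at P) v
     - frechet_derivative (\<lambda>Q. g Q u v) (at P) e)"

definition nabla ::
    "(real^'n \<Rightarrow> real^'n \<Rightarrow> real^'n \<Rightarrow> real) \<Rightarrow> (real^'n \<Rightarrow> real^'n) \<Rightarrow> (real^'n \<Rightarrow> real^'n)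
      \<Rightarrow> real^'n \<Rightarrow> real^'n" where
  "nabla g \<xi> \<eta> = (\<lambda>P. frechet_derivative \<eta> (at P) (\<xi> P) + christoffel g P (\<xi> P) (\<eta> P))"

definition lie_bracket :: "(real^'n \<Rightarrow> real^'n) \<Rightarrow> (real^'n \<Rightarrow> real^'n) \<Rightarrow> real^'n \<Rightarrow> real^'n" where
  "lie_bracket \<xi> \<eta> = (\<lambda>P. frechet_derivative \<eta> (at P) (\<xi> P) - frechet_derivative \<xi> (at P) (\<eta> P))"

definition curvature_operator ::
    "(real^'n \<Rightarrow> real^'n \<Rightarrow> real^'n \<Rightarrow> real) \<Rightarrow> (real^'n \<Rightarrow> real^'n) \<Rightarrow> (real^'n \<Rightarrow> real^'n)
      \<Rightarrow> (real^'n \<Rightarrow> real^'n) \<Rightarrow> real^'n \<Rightarrow> real^'n" where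
  "curvature_operator g \<xi>1 \<xi>2 \<xi>3 = (\<lambda>P.
     nabla g \<xi>1 (nabla g \<xi>2 \<xi>3) P - nabla g \<xi>2 (nabla g \<xi>1 \<xi>3) P
     - nabla g (lie_bracket \<xi>1 \<xi>2) \<xi>3 P)"

text \<open>
  Tensorial in its four arguments, so it may be evaluated on constant extensions of the tangent
  vectors; the same applies to the covariant derivative of a covariant tensor field below.
\<close>

definition curvature_tensor ::
    "(real^'n \<Rightarrow> real^'n \<Rightarrow> real^'n \<Rightarrow> real) \<Rightarrow> real^'n
      \<Rightarrow> real^'n \<Rightarrow> real^'n \<Rightarrow> real^'n \<Rightarrow> real^'n \<Rightarrow> real" where
  "curvature_tensor g P v1 v2 v3 v4 =
     g P (curvature_operator g (\<lambda>_. v1) (\<lambda>_. v2) (\<lambda>_. v3) P) v4"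

text \<open>
  A covariant tensor field of rank \<open>r\<close> is a function of a point and a list of \<open>r\<close> tangent vectors.
  The direction of covariant differentiation is appended as the last entry of the list.
\<close>

definition covariant_derivative ::
    "(real^'n \<Rightarrow> real^'n \<Rightarrow> real^'n \<Rightarrow> real) \<Rightarrow> (real^'n \<Rightarrow> (real^'n) list \<Rightarrow> real)
      \<Rightarrow> real^'n \<Rightarrow> (real^'n) list \<Rightarrow> real" where
  "covariant_derivative g T P vs =
     (let ws = butlast vs; \<eta> = last vs in
        frechet_derivative (\<lambda>Q. T Q ws) (at P) \<eta>
        - (\<Sum>i<length ws. T P (ws[i := christoffel g P \<eta> (ws ! i)])))"

primrec nabla_curvature ::
    "(real^'n \<Rightarrow> real^'n \<Rightarrow> real^'n \<Rightarrow> real) \<Rightarrow> nat \<Rightarrow> real^'n \<Rightarrow> (real^'n) list \<Rightarrow> real" where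
  "nabla_curvature g 0 = (\<lambda>P vs. curvature_tensor g P (vs!0) (vs!1) (vs!2) (vs!3))"
| "nabla_curvature g (Suc k) = covariant_derivative g (nabla_curvature g k)"

section \<open>Geodesics and the exponential map\<close>

definition geodesic_on ::
    "(real^'n \<Rightarrow> real^'n \<Rightarrow> real^'n \<Rightarrow> real) \<Rightarrow> real set \<Rightarrow> (real \<Rightarrow> real^'n) \<Rightarrow> bool" where
  "geodesic_on g I \<gamma> \<longleftrightarrow> open I \<and> is_interval I \<and>
     (\<exists>\<gamma>'. \<forall>t\<in>I. (\<gamma> has_vector_derivative \<gamma>' t) (at t) \<and>
        (\<gamma>' has_vector_derivative - christoffel g (\<gamma> t) (\<gamma>' t) (\<gamma>' t)) (at t))"

definition geodesically_complete :: "(real^'n \<Rightarrow> real^'n \<Rightarrow> real^'n \<Rightarrow> real) \<Rightarrow> bool" where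
  "geodesically_complete g \<longleftrightarrow>
     (\<forall>I \<gamma>. geodesic_on g I \<gamma> \<longrightarrow> (\<exists>\<sigma>. geodesic_on g UNIV \<sigma> \<and> (\<forall>t\<in>I. \<sigma> t = \<gamma> t)))"

definition exp_relation ::
    "(real^'n \<Rightarrow> real^'n \<Rightarrow> real^'n \<Rightarrow> real) \<Rightarrow> real^'n \<Rightarrow> real^'n \<Rightarrow> real^'n \<Rightarrow> bool" where
  "exp_relation g P v q \<longleftrightarrow> (\<exists>I \<gamma>. geodesic_on g I \<gamma> \<and> {0..1} \<subseteq> I \<and>
     \<gamma> 0 = P \<and> (\<gamma> has_vector_derivative v) (at 0) \<and> \<gamma> 1 = q)"

definition exp_map ::
    "(real^'n \<Rightarrow> real^'n \<Rightarrow> real^'n \<Rightarrow> real) \<Rightarrow> real^'n \<Rightarrow> real^'n \<Rightarrow> real^'n" where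
  "exp_map g P v = (THE q. exp_relation g P v q)"

text \<open>
  The first conjunct says that the exponential map is defined on the whole tangent space, which
  the definite description above would otherwise leave open.
\<close>

definition exp_is_diffeomorphism ::
    "(real^'n \<Rightarrow> real^'n \<Rightarrow> real^'n \<Rightarrow> real) \<Rightarrow> real^'n \<Rightarrow> bool" where
  "exp_is_diffeomorphism g P \<longleftrightarrow>
     (\<forall>v. \<exists>!q. exp_relation g P v q) \<and> diffeomorphism (exp_map g P)"

section \<open>Models\<close>

definition multilinear :: "nat \<Rightarrow> ('v::real_vector list \<Rightarrow> real) \<Rightarrow> bool" where
  "multilinear r A \<longleftrightarrow> (\<forall>vs i. length vs = r \<longrightarrow> i < r \<longrightarrow> linear (\<lambda>v. A (vs[i := v])))"

definition k_model :: "nat \<Rightarrow> ('v::real_vector \<Rightarrow> 'v \<Rightarrow> real) \<Rightarrow> (nat \<Rightarrow> 'v list \<Rightarrow> real) \<Rightarrow> bool" where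
  "k_model k b A \<longleftrightarrow>
     (\<exists>B::'v set. finite B \<and> span B = UNIV) \<and> inner_product_form b \<and>
     (\<forall>i\<le>k. multilinear (4 + i) (A i))"

definition k_model_for ::
    "nat \<Rightarrow> ('v::real_vector \<Rightarrow> 'v \<Rightarrow> real) \<Rightarrow> (nat \<Rightarrow> 'v list \<Rightarrow> real)
      \<Rightarrow> (real^'n \<Rightarrow> real^'n \<Rightarrow> real^'n \<Rightarrow> real) \<Rightarrow> bool" where
  "k_model_for k b A g \<longleftrightarrow> k_model k b A \<and>
     (\<forall>P. \<exists>\<phi>::real^'n \<Rightarrow> 'v. linear \<phi> \<and> bij \<phi> \<and>
        (\<forall>u v. b (\<phi> u) (\<phi> v) = g P u v) \<and>
        (\<forall>i\<le>k. \<forall>vs. length vs = 4 + i \<longrightarrow> A i (map \<phi> vs) = nabla_curvature g i P vs))"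

section \<open>The manifolds and the models in question\<close>

text \<open>
  The coordinates are indexed by a type whose parameter \<open>'i\<close> indexes the variables
  \<open>z\<close>; the suffix \<open>b\<close> stands for a bar. An enumeration \<open>idx\<close> with
  \<open>bij_betw idx {..p} UNIV\<close> makes \<open>Z (idx k)\<close> the index of the \<open>k\<close>-th variable \<open>z\<close>, for
  \<open>0 \<le> k \<le> p\<close>, so that \<open>real ^ 'i coord\<close> has dimension \<open>2 * p + 6\<close>.
\<close>

datatype 'i coord = X | Y | Z 'i | Xb | Yb | Zb 'i

lemma UNIV_coord: "(UNIV :: 'i coord set) = {X, Y, Xb, Yb} \<union> range Z \<union> range Zb"
proof -
  have "c \<in> {X, Y, Xb, Yb} \<union> range Z \<union> range Zb" for c :: "'i coord"
    by (cases c) auto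
  then show ?thesis by blast
qed

instance coord :: (finite) finite
  by standard (simp add: UNIV_coord)

lemma CARD_coord: "CARD('i::finite coord) = 2 * CARD('i) + 4"
proof -
  have "card (range (Z :: 'i \<Rightarrow> _) \<union> range Zb) = CARD('i) + CARD('i)"
    by (subst card_Un_disjoint) (auto simp: card_image inj_def)
  moreover have "card ({X, Y, Xb, Yb} \<union> (range (Z :: 'i \<Rightarrow> _) \<union> range Zb))
      = 4 + card (range (Z :: 'i \<Rightarrow> _) \<union> range Zb)"
    by (subst card_Un_disjoint) auto
  ultimately show ?thesis by (simp add: UNIV_coord Un_assoc)
qed

lemma DIM_coord:
  assumes "bij_betw idx {..p} (UNIV :: 'i::finite set)"
  shows "DIM(real ^ 'i coord) = 2 * p + 6"
  using bij_betw_same_card[OF assms] by (simp add: CARD_coord)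

definition flat_form :: "real ^ 'i::finite coord \<Rightarrow> real ^ 'i coord \<Rightarrow> real" where
  "flat_form u v =
     u $ X * v $ Xb + u $ Xb * v $ X + u $ Y * v $ Yb + u $ Yb * v $ Y
     + (\<Sum>j\<in>UNIV. u $ Z j * v $ Zb j + u $ Zb j * v $ Z j)"

definition potential ::
    "nat \<Rightarrow> (real \<Rightarrow> real) \<Rightarrow> (nat \<Rightarrow> 'i::finite) \<Rightarrow> real ^ 'i coord \<Rightarrow> real" where
  "potential p f idx P = f (P $ Y) + (\<Sum>j\<le>p. (P $ Y) ^ (j + 1) * P $ Z (idx j))"

definition neutral_metric ::
    "nat \<Rightarrow> (real \<Rightarrow> real) \<Rightarrow> (nat \<Rightarrow> 'i::finite)
      \<Rightarrow> real ^ 'i coord \<Rightarrow> real ^ 'i coord \<Rightarrow> real ^ 'i coord \<Rightarrow> real" where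
  "neutral_metric p f idx P u v = flat_form u v - 2 * potential p f idx P * u $ X * v $ X"

text \<open>
  The index tuples at which the \<open>k\<close>-th tensor of the model is prescribed to be 1; for \<open>k = 0\<close>
  this is only \<open>[X, Y, Z (idx 0), X]\<close>.
\<close>

definition unit_entries :: "nat \<Rightarrow> (nat \<Rightarrow> 'i) \<Rightarrow> nat \<Rightarrow> 'i coord list set" where
  "unit_entries p idx k =
    (if k \<le> p then
       insert ([X, Y, Z (idx k), X] @ replicate k Y)
         {[X, Y, Y, X] @ (replicate k Y)[j := Z (idx k)] | j. j < k}
     else if k \<le> p + 2 then {[X, Y, Y, X] @ replicate k Y}
     else {})"

text \<open>
  The remaining components: the two symmetries generate a group of order eight on the first four
  slots. Its elements that preserve the component come first, those that change its sign second.
  All components outside the orbits of \<open>unit_entries\<close> vanish.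
\<close>

definition model_component :: "nat \<Rightarrow> (nat \<Rightarrow> 'i) \<Rightarrow> nat \<Rightarrow> 'i coord list \<Rightarrow> real" where
  "model_component p idx k cs =
    (case cs of
       a # b # c # d # es \<Rightarrow>
         (if {a#b#c#d#es, b#a#d#c#es, c#d#a#b#es, d#c#b#a#es} \<inter> unit_entries p idx k \<noteq> {}
          then 1
          else if {b#a#c#d#es, a#b#d#c#es, c#d#b#a#es, d#c#a#b#es} \<inter> unit_entries p idx k \<noteq> {}
          then - 1
          else 0)
     | _ \<Rightarrow> 0)"

definition model_tensor ::
    "nat \<Rightarrow> (nat \<Rightarrow> 'i::finite) \<Rightarrow> nat \<Rightarrow> (real ^ 'i coord) list \<Rightarrow> real" where
  "model_tensor p idx k vs =
     (\<Sum>cs | length cs = 4 + k. model_component p idx k cs * (\<Prod>j<4 + k. vs ! j $ cs ! j))"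

section \<open>Consistency checks\<close>

lemma model_component_unit:
  assumes "cs \<in> unit_entries p idx k"
  shows "model_component p idx k cs = 1"
  using assms by (auto simp: model_component_def unit_entries_def split: if_splits)

lemma model_component_skew:
  "model_component p idx k (b # a # c # d # es) = - model_component p idx k (a # b # c # d # es)"
  by (auto simp: model_component_def unit_entries_def)

lemma model_component_pair:
  "model_component p idx k (c # d # a # b # es) = model_component p idx k (a # b # c # d # es)"
  unfolding model_component_def by (simp add: insert_commute Int_commute)

text \<open>The metric is a pseudo-Riemannian metric.\<close>

lemma times_differentiable_Suc: "times_differentiable (Suc k) f \<Longrightarrow> times_differentiable k f"
  by (induction k arbitrary: f)
    (auto intro!: continuous_at_imp_continuous_on differentiable_imp_continuous_within)

lemma times_differentiable_const [simp]: "times_differentiable k (\<lambda>x. c)"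
  by (induction k arbitrary: c) auto

lemma frechet_derivative_add:
  assumes "f differentiable (at x)" "g differentiable (at x)"
  shows "frechet_derivative (\<lambda>x. f x + g x) (at x) =
    (\<lambda>v. frechet_derivative f (at x) v + frechet_derivative g (at x) v)"
  by (rule frechet_derivative_at[OF has_derivative_add, symmetric])
    (use assms in \<open>simp_all add: frechet_derivative_works[symmetric]\<close>)

lemma times_differentiable_add:
  "times_differentiable k f \<Longrightarrow> times_differentiable k g \<Longrightarrow> times_differentiable k (\<lambda>x. f x + g x)"
  by (induction k arbitrary: f g) (auto intro: continuous_on_add simp: frechet_derivative_add)

lemma times_differentiable_mult:
  fixes f g :: "'a::euclidean_space \<Rightarrow> real"
  shows "times_differentiable k f \<Longrightarrow> times_differentiable k g \<Longrightarrow> times_differentiable k (\<lambda>x. f x * g x)"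
proof (induction k arbitrary: f g)
  case 0
  then show ?case by (auto intro: continuous_on_mult)
next
  case (Suc k)
  have d: "frechet_derivative (\<lambda>x. f x * g x) (at x) v =
      f x * frechet_derivative g (at x) v + frechet_derivative f (at x) v * g x" for x v
    by (subst frechet_derivative_at[OF has_derivative_mult, symmetric])
      (use Suc.prems in \<open>auto simp: frechet_derivative_works[symmetric]\<close>)
  have "times_differentiable k f" "times_differentiable k g"
    using Suc.prems by (auto intro: times_differentiable_Suc simp del: times_differentiable.simps)
  with Suc show ?case
    by (auto simp: d intro!: times_differentiable_add)
qed

lemma times_differentiable_linear:
  fixes L :: "'a::euclidean_space \<Rightarrow> 'b::real_normed_vector"
  assumes "bounded_linear L"
  shows "times_differentiable k L"
proof (cases k)
  case 0
  then show ?thesis using assms by (simp add: linear_continuous_on)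
next
  case (Suc j)
  have "frechet_derivative L (at x) = L" for x
    using assms by (metis bounded_linear_imp_has_derivative frechet_derivative_at)
  with Suc assms show ?thesis
    by (auto intro: bounded_linear_imp_differentiable)
qed

lemma times_differentiable_compose_linear:
  fixes L :: "'a::euclidean_space \<Rightarrow> 'b::euclidean_space"
  assumes L: "bounded_linear L"
  shows "times_differentiable k f \<Longrightarrow> times_differentiable k (\<lambda>x. f (L x))"
proof (induction k arbitrary: f)
  case 0
  then show ?case
    using linear_continuous_on[OF L] by (auto intro: continuous_on_compose2)
next
  case (Suc k)
  have d: "((\<lambda>x. f (L x)) has_derivative (\<lambda>v. frechet_derivative f (at (L x)) (L v))) (at x)" for x
    by (rule has_derivative_compose[OF bounded_linear_imp_has_derivative[OF L]])
      (use Suc.prems in \<open>auto simp: frechet_derivative_works[symmetric]\<close>)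
  have "frechet_derivative (\<lambda>x. f (L x)) (at x) = (\<lambda>v. frechet_derivative f (at (L x)) (L v))" for x
    using frechet_derivative_at[OF d] by simp
  moreover have "times_differentiable k (\<lambda>x. frechet_derivative f (at (L x)) (L v))" for v
    using Suc.prems by (intro Suc.IH[where f = "\<lambda>y. frechet_derivative f (at y) (L v)"]) simp
  ultimately show ?case
    using d by (auto simp: differentiable_def)
qed

lemma times_differentiable_power:
  fixes f :: "'a::euclidean_space \<Rightarrow> real"
  shows "times_differentiable k f \<Longrightarrow> times_differentiable k (\<lambda>x. f x ^ n)"
  by (induction n) (auto intro: times_differentiable_mult)

lemma times_differentiable_sum:
  "finite S \<Longrightarrow> (\<And>j. j \<in> S \<Longrightarrow> times_differentiable k (f j)) \<Longrightarrow>
     times_differentiable k (\<lambda>x. \<Sum>j\<in>S. f j x)"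
  by (induction S rule: finite_induct) (auto intro: times_differentiable_add)

lemma inner_product_form_metric: "inner_product_form (neutral_metric p f idx P)"
  unfolding inner_product_form_def
proof (intro conjI allI impI)
  show "linear (neutral_metric p f idx P u)" for u
    by (rule linearI)
      (simp_all add: neutral_metric_def flat_form_def algebra_simps sum.distrib sum_distrib_left)
  show "neutral_metric p f idx P u v = neutral_metric p f idx P v u" for u v
    by (simp add: neutral_metric_def flat_form_def algebra_simps sum.distrib)
  show "u = 0" if u: "\<forall>v. neutral_metric p f idx P u v = 0" for u
  proof -
    note unfold = neutral_metric_def flat_form_def axis_def sum.distrib if_distrib[of "(*) a" for a]
    have ux: "u $ X = 0"
      using u[rule_format, of "axis Xb 1"] by (simp add: unfold cong: if_cong)
    have "u $ Xb = 0" using u[rule_format, of "axis X 1"] ux by (simp add: unfold cong: if_cong)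
    moreover have "u $ Y = 0" using u[rule_format, of "axis Yb 1"] by (simp add: unfold cong: if_cong)
    moreover have "u $ Yb = 0" using u[rule_format, of "axis Y 1"] by (simp add: unfold cong: if_cong)
    moreover have "u $ Z j = 0" for j using u[rule_format, of "axis (Zb j) 1"] by (simp add: unfold cong: if_cong)
    moreover have "u $ Zb j = 0" for j using u[rule_format, of "axis (Z j) 1"] by (simp add: unfold cong: if_cong)
    ultimately have "u $ c = 0" for c using ux by (cases c) auto
    then show "u = 0" by (simp add: vec_eq_iff)
  qed
qed

lemma pseudo_riemannian_metric:
  fixes idx :: "nat \<Rightarrow> 'a::finite"
  assumes "smooth_map f"
  shows "pseudo_riemannian (neutral_metric p f idx)"
proof -
  have "times_differentiable k (\<lambda>P. neutral_metric p f idx P u v)" for k u v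
  proof -
    have coord: "times_differentiable k (\<lambda>P :: real ^ 'a coord. P $ c)" for c :: "'a coord"
      by (rule times_differentiable_linear[OF bounded_linear_vec_nth])
    have "times_differentiable k (\<lambda>P :: real ^ 'a coord. f (P $ Y))"
      using assms by (intro times_differentiable_compose_linear[OF bounded_linear_vec_nth, of k f])
        (simp add: smooth_map_def)
    moreover have "times_differentiable k (\<lambda>P :: real ^ 'a coord. \<Sum>j\<le>p. (P $ Y) ^ (j + 1) * P $ Z (idx j))"
    proof (rule times_differentiable_sum)
      show "times_differentiable k (\<lambda>P :: real ^ 'a coord. (P $ Y) ^ (j + 1) * P $ Z (idx j))" for j
        by (intro times_differentiable_mult times_differentiable_power coord)
    qed simp
    ultimately have "times_differentiable k (\<lambda>P. potential p f idx P)"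
      unfolding potential_def by (rule times_differentiable_add)
    then have "times_differentiable k
        (\<lambda>P. flat_form u v + (- 2 * u $ X * v $ X) * potential p f idx P)"
      by (intro times_differentiable_add times_differentiable_mult times_differentiable_const)
    then show ?thesis by (simp add: neutral_metric_def algebra_simps)
  qed
  then show ?thesis
    by (simp add: pseudo_riemannian_def smooth_map_def inner_product_form_metric)
qed

text \<open>
  For every pseudo-Riemannian metric, \<open>nabla\<close> is the Levi-Civita connection: it is torsion-free
  and compatible with the metric.
\<close>

lemma linear_form_representable:
  fixes b :: "real^'n \<Rightarrow> real^'n \<Rightarrow> real"
  assumes b: "inner_product_form b" and h: "linear h"
  shows "\<exists>!w. \<forall>e. b w e = h e"
proof -
  have lin: "linear (b u)" and sym: "b u v = b v u" for u v
    using b by (auto simp: inner_product_form_def)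
  have nondeg: "u = 0" if "\<And>v. b u v = 0" for u
    using b that by (auto simp: inner_product_form_def)
  have lin1: "linear (\<lambda>u. b u v)" for v
    using lin[of v] by (simp add: sym[of _ v])
  have ext: "l = m" if "linear l" "linear m" "\<And>i. l (axis i 1) = m (axis i 1)"
    for l m :: "real^'n \<Rightarrow> real"
    using linear_eq_stdbasis[OF that(1,2)] that(3) by (auto simp: Basis_vec_def)
  define T where "T w = (\<chi> i. b w (axis i 1))" for w
  have T: "linear T"
    by (rule linearI) (simp_all add: T_def vec_eq_iff linear_add[OF lin1] linear_cmul[OF lin1])
  have inj: "inj T"
  proof (subst linear_injective_0[OF T], intro allI impI)
    fix w assume "T w = 0"
    then have "b w (axis i 1) = 0" for i by (simp add: T_def vec_eq_iff)
    then have "b w = (\<lambda>_. 0)" by (intro ext lin) (auto intro: linear_zero)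
    then show "w = 0" using nondeg by metis
  qed
  then obtain w where w: "T w = (\<chi> i. h (axis i 1))"
    using linear_injective_imp_surjective[OF T] by (metis surjD)
  have "b w = h"
    by (rule ext[OF lin h]) (use w in \<open>simp add: T_def vec_eq_iff\<close>)
  moreover have "w' = w" if "\<forall>e. b w' e = h e" for w'
    using that w inj by (auto simp: T_def inj_def)
  ultimately show ?thesis by auto
qed

lemma smooth_map_differentiable: "smooth_map f \<Longrightarrow> f differentiable (at x)"
  by (auto simp: smooth_map_def dest: spec[of _ "Suc 0"])

lemma christoffel_Koszul:
  assumes g: "pseudo_riemannian g"
  shows "2 * g P (christoffel g P u v) e =
       frechet_derivative (\<lambda>Q. g Q v e) (at P) u
     + frechet_derivative (\<lambda>Q. g Q u e) (at P) v
     - frechet_derivative (\<lambda>Q. g Q u v) (at P) e"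
proof -
  define h where "h e = frechet_derivative (\<lambda>Q. g Q v e) (at P) u
     + frechet_derivative (\<lambda>Q. g Q u e) (at P) v
     - frechet_derivative (\<lambda>Q. g Q u v) (at P) e" for e
  have diff: "(\<lambda>Q. g Q a b) differentiable (at P)" for a b
    using g by (auto simp: pseudo_riemannian_def intro: smooth_map_differentiable)
  have lin: "linear (g Q a)" for Q a
    using g by (auto simp: pseudo_riemannian_def inner_product_form_def)
  have dlin: "linear (\<lambda>b. frechet_derivative (\<lambda>Q. g Q a b) (at P) c)" for a c
  proof (rule linearI)
    show "frechet_derivative (\<lambda>Q. g Q a (x + y)) (at P) c =
        frechet_derivative (\<lambda>Q. g Q a x) (at P) c + frechet_derivative (\<lambda>Q. g Q a y) (at P) c" for x y
      by (simp add: linear_add[OF lin] frechet_derivative_add diff)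
    show "frechet_derivative (\<lambda>Q. g Q a (r *\<^sub>R x)) (at P) c =
        r *\<^sub>R frechet_derivative (\<lambda>Q. g Q a x) (at P) c" for r x
    proof -
      have "((\<lambda>Q. r * g Q a x) has_derivative
          (\<lambda>c. r * frechet_derivative (\<lambda>Q. g Q a x) (at P) c)) (at P)"
        using diff by (intro has_derivative_mult_right) (simp add: frechet_derivative_works[symmetric])
      from frechet_derivative_at[OF this] show ?thesis
        by (simp add: linear_cmul[OF lin] fun_eq_iff)
    qed
  qed
  have "linear h"
    unfolding h_def
    by (intro linear_compose_add linear_compose_sub dlin linear_frechet_derivative diff)
  then have "linear (\<lambda>e. h e / 2)"
    using linear_compose_scale_right[of h "1/2"] by simp
  then have "\<exists>!w. \<forall>e. g P w e = h e / 2"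
    using g by (intro linear_form_representable) (auto simp: pseudo_riemannian_def)
  then have "\<exists>!w. \<forall>e. 2 * g P w e = h e"
    by (simp add: field_simps)
  from theI'[OF this] show ?thesis
    by (simp add: christoffel_def h_def)
qed

lemma nabla_torsion_free:
  assumes "pseudo_riemannian g"
  shows "nabla g \<xi> \<eta> P - nabla g \<eta> \<xi> P = lie_bracket \<xi> \<eta> P"
proof -
  have "(\<lambda>Q. g Q u v) = (\<lambda>Q. g Q v u)" for u v
    using assms by (auto simp: pseudo_riemannian_def inner_product_form_def)
  then have "christoffel g P u v = christoffel g P v u" for u v
    unfolding christoffel_def by (metis (no_types, lifting) add.commute)
  then show ?thesis
    by (simp add: nabla_def lie_bracket_def)
qed

lemma nabla_metric_compatible:
  assumes g: "pseudo_riemannian g"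
    and \<eta>: "\<eta> differentiable (at P)" and \<zeta>: "\<zeta> differentiable (at P)"
  shows "frechet_derivative (\<lambda>Q. g Q (\<eta> Q) (\<zeta> Q)) (at P) (\<xi> P) =
    g P (nabla g \<xi> \<eta> P) (\<zeta> P) + g P (\<eta> P) (nabla g \<xi> \<zeta> P)"
proof -
  have sym: "g Q u v = g Q v u" and lin: "linear (g Q u)" for Q u v
    using g by (auto simp: pseudo_riemannian_def inner_product_form_def)
  have lin1: "linear (\<lambda>u. g Q u v)" for Q v
    using lin[of Q v] by (simp add: sym[of Q _ v])
  have diff: "(\<lambda>Q. g Q a b) differentiable (at P)" for a b
    using g by (auto simp: pseudo_riemannian_def intro: smooth_map_differentiable)
  have exp: "g Q u v = (\<Sum>i\<in>UNIV. \<Sum>j\<in>UNIV. u $ i * v $ j * g Q (axis i 1) (axis j 1))" for Q u v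
  proof -
    have "g Q u v = g Q (\<Sum>i\<in>UNIV. u $ i *\<^sub>R axis i 1) (\<Sum>j\<in>UNIV. v $ j *\<^sub>R axis j 1)"
      by (simp add: basis_expansion scalar_mult_eq_scaleR[symmetric])
    also have "\<dots> = (\<Sum>i\<in>UNIV. \<Sum>j\<in>UNIV. u $ i * v $ j * g Q (axis i 1) (axis j 1))"
      by (simp add: linear_sum[OF lin] linear_sum[OF lin1] linear_cmul[OF lin] linear_cmul[OF lin1]
          sum_distrib_left mult.assoc mult.left_commute)
        (subst sum.swap, simp add: mult.left_commute)
    finally show ?thesis .
  qed
  define D where "D a b = frechet_derivative (\<lambda>Q. g Q a b) (at P)" for a b
  define \<eta>' where "\<eta>' = frechet_derivative \<eta> (at P)"
  define \<zeta>' where "\<zeta>' = frechet_derivative \<zeta> (at P)"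
  have dg: "((\<lambda>Q. g Q a b) has_derivative D a b) (at P)" for a b
    using diff by (simp add: D_def frechet_derivative_works[symmetric])
  have d\<eta>: "((\<lambda>Q. \<eta> Q $ i) has_derivative (\<lambda>v. \<eta>' v $ i)) (at P)" for i
    using \<eta> by (intro bounded_linear.has_derivative[OF bounded_linear_vec_nth])
      (simp add: \<eta>'_def frechet_derivative_works[symmetric])
  have d\<zeta>: "((\<lambda>Q. \<zeta> Q $ i) has_derivative (\<lambda>v. \<zeta>' v $ i)) (at P)" for i
    using \<zeta> by (intro bounded_linear.has_derivative[OF bounded_linear_vec_nth])
      (simp add: \<zeta>'_def frechet_derivative_works[symmetric])
  have D_exp: "D a b v = (\<Sum>i\<in>UNIV. \<Sum>j\<in>UNIV. a $ i * b $ j * D (axis i 1) (axis j 1) v)" for a b v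
  proof -
    have "((\<lambda>Q. \<Sum>i\<in>UNIV. \<Sum>j\<in>UNIV. a $ i * b $ j * g Q (axis i 1) (axis j 1)) has_derivative
        (\<lambda>v. \<Sum>i\<in>UNIV. \<Sum>j\<in>UNIV. a $ i * b $ j * D (axis i 1) (axis j 1) v)) (at P)"
      by (intro has_derivative_sum has_derivative_mult_right dg)
    moreover have "(\<lambda>Q. \<Sum>i\<in>UNIV. \<Sum>j\<in>UNIV. a $ i * b $ j * g Q (axis i 1) (axis j 1)) =
        (\<lambda>Q. g Q a b)"
      by (rule HOL.ext, rule exp[symmetric])
    ultimately show ?thesis
      using has_derivative_unique[OF dg] by (simp add: fun_eq_iff)
  qed
  have "((\<lambda>Q. \<Sum>i\<in>UNIV. \<Sum>j\<in>UNIV. \<eta> Q $ i * \<zeta> Q $ j * g Q (axis i 1) (axis j 1)) has_derivative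
      (\<lambda>v. \<Sum>i\<in>UNIV. \<Sum>j\<in>UNIV. \<eta> P $ i * \<zeta> P $ j * D (axis i 1) (axis j 1) v
         + (\<eta> P $ i * \<zeta>' v $ j + \<eta>' v $ i * \<zeta> P $ j) * g P (axis i 1) (axis j 1))) (at P)"
    by (intro has_derivative_sum has_derivative_mult dg d\<eta> d\<zeta>)
  then have "((\<lambda>Q. g Q (\<eta> Q) (\<zeta> Q)) has_derivative
      (\<lambda>v. D (\<eta> P) (\<zeta> P) v + (g P (\<eta> P) (\<zeta>' v) + g P (\<eta>' v) (\<zeta> P)))) (at P)"
    by (subst exp, subst D_exp, subst (2 3) exp) (simp add: distrib_right sum.distrib)
  from frechet_derivative_at[OF this, symmetric]
  have "frechet_derivative (\<lambda>Q. g Q (\<eta> Q) (\<zeta> Q)) (at P) (\<xi> P) =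
      D (\<eta> P) (\<zeta> P) (\<xi> P) + (g P (\<eta> P) (\<zeta>' (\<xi> P)) + g P (\<eta>' (\<xi> P)) (\<zeta> P))"
    by simp
  moreover have "D (\<eta> P) (\<zeta> P) (\<xi> P) =
      g P (christoffel g P (\<xi> P) (\<eta> P)) (\<zeta> P) + g P (\<eta> P) (christoffel g P (\<xi> P) (\<zeta> P))"
  proof -
    have Dsym: "D a b = D b a" for a b
      unfolding D_def by (subst sym) simp
    have "2 * g P (christoffel g P u v) w = D v w u + D u w v - D u v w" for u v w
      using christoffel_Koszul[OF g] by (simp add: D_def)
    from this[of "\<xi> P" "\<eta> P" "\<zeta> P"] this[of "\<xi> P" "\<zeta> P" "\<eta> P"]
    show ?thesis
      by (simp add: sym[of P "\<eta> P"] Dsym[of "\<zeta> P" "\<eta> P"])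
  qed
  ultimately show ?thesis
    by (simp add: nabla_def \<eta>'_def \<zeta>'_def linear_add[OF lin] linear_add[OF lin1])
qed

end

theory Submission
  imports Defs
begin

text \<open>
  The metric differs from a flat one only in \<open>g(\<partial>\<^sub>x, \<partial>\<^sub>x) = -2F\<close>, and \<open>F\<close> depends only on \<open>y\<close> and the
  \<open>z\<^sub>j\<close>. Call the coordinates without a bar the base coordinates. By the Koszul formula
  (\<open>christoffel_eq_connection\<close>), the values of the Christoffel symbols have only barred components,
  while the symbols themselves depend only on the base components of the point and of the two
  arguments. All parts of the theorem rest on this nilpotency.

  Geodesics: the base components of a geodesic have acceleration zero, so they are affine in time.
  The acceleration of the barred components is then a known smooth function of time, and
  integrating it twice gives a geodesic for all times. At time 1, Taylor's formula with integral
  remainder yields \<open>exp\<^sub>P(v) = P + v - D(v)\<close> with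
  \<open>D(v) = \<integral>\<^sub>0\<^sup>1 (1 - s) \<Gamma>\<^bsub>P + s v\<^esub>(v, v) ds\<close>. The map \<open>D\<close> is smooth, has only barred
  components and depends only on the base components, so \<open>q \<mapsto> (q - P) + D(q - P)\<close> is
  a smooth inverse.

  Curvature: products of Christoffel symbols vanish, and so do all correction terms in the
  covariant derivatives of \<open>R\<close>. Hence \<open>\<nabla>\<^sup>kR\<close> is the Kulkarni-Nomizu product of \<open>dx\<^sup>2\<close> with the
  ordinary derivative \<open>d\<^bsup>k+2\<^esup>F\<close> (\<open>nabla_curvature_eq\<close>). Since \<open>F\<close> is affine in \<open>z\<close>,
  \<open>d\<^sup>nF\<close> is a multiple of \<open>dy\<^sup>n\<close> plus a symmetric product of \<open>dy\<^bsup>n-1\<^esup>\<close> with a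
  linear form in \<open>dz\<close> (\<open>jet\<close>). The model tensor \<open>A\<^sup>k\<close> is the Kulkarni-Nomizu product of \<open>X\<^sup>2\<close> with
  the symmetric product of \<open>Y\<^bsup>k+1\<^esup>\<close> and \<open>Z\<^sub>k\<close> for \<open>k \<le> p\<close>, and with
  \<open>Y\<^bsup>k+2\<^esup>\<close> for \<open>k = p + 1, p + 2\<close> (\<open>model_tensor_eq\<close>).

  Matching: a linear map with \<open>X \<mapsto> \<alpha> dx\<close>, \<open>Y \<mapsto> \<beta> dy\<close> on coordinates identifies these
  tensors for all \<open>k \<le> p\<close> as soon as the coordinate \<open>Z\<^sub>k\<close> is sent to the correct combination of
  \<open>dy\<close> and the \<open>dz\<^sub>j\<close>. The coefficients of \<open>dz\<^sub>j\<close> are derivatives of \<open>y\<^bsup>j+1\<^esup>\<close>, which form a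
  triangular matrix with diagonal entries \<open>(k + 1)!\<close>, so the map is invertible on the base
  coordinates; the inverse transpose on the barred ones makes it an isometry
  (\<open>normalising_isometry\<close>). The scales \<open>\<alpha>\<close> and \<open>\<beta>\<close> are still free, and for
  \<open>k = p + 1, p + 2\<close> they have to satisfy \<open>\<alpha>\<^sup>2 \<beta>\<^bsup>p+3\<^esup> = f\<^bsup>(p+3)\<^esup>(y)\<close> and
  \<open>\<alpha>\<^sup>2 \<beta>\<^bsup>p+4\<^esup> = f\<^bsup>(p+4)\<^esup>(y)\<close>. Positivity of both derivatives makes this solvable.
\<close>

section \<open>Smooth maps and averages along segments\<close>

lemma times_differentiable_bounded_linear:
  fixes f :: "'a::euclidean_space \<Rightarrow> 'b::real_normed_vector"
    and L :: "'b \<Rightarrow> 'c::real_normed_vector"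
  assumes L: "bounded_linear L"
  shows "times_differentiable k f \<Longrightarrow> times_differentiable k (\<lambda>x. L (f x))"
proof (induction k arbitrary: f)
  case 0
  then show ?case
    using linear_continuous_on[OF L, of UNIV] by (auto intro: continuous_on_compose2)
next
  case (Suc k)
  have d: "((\<lambda>x. L (f x)) has_derivative (\<lambda>v. L (frechet_derivative f (at x) v))) (at x)" for x
    using Suc.prems
    by (intro bounded_linear.has_derivative[OF L]) (auto simp: frechet_derivative_works[symmetric])
  show ?case
    using d Suc by (auto simp: differentiable_def frechet_derivative_at[OF d, symmetric])
qed

lemma smooth_map_const: "smooth_map (\<lambda>x. c)"
  by (simp add: smooth_map_def)

lemma smooth_map_add: "smooth_map f \<Longrightarrow> smooth_map g \<Longrightarrow> smooth_map (\<lambda>x. f x + g x)"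
  by (simp add: smooth_map_def times_differentiable_add)

lemma smooth_map_mult:
  fixes f g :: "'a::euclidean_space \<Rightarrow> real"
  shows "smooth_map f \<Longrightarrow> smooth_map g \<Longrightarrow> smooth_map (\<lambda>x. f x * g x)"
  by (simp add: smooth_map_def times_differentiable_mult)

lemma smooth_map_minus: "smooth_map f \<Longrightarrow> smooth_map (\<lambda>x. - f x)"
  by (auto simp: smooth_map_def
      intro: times_differentiable_bounded_linear[OF bounded_linear_minus[OF bounded_linear_ident]])

lemma smooth_map_diff: "smooth_map f \<Longrightarrow> smooth_map g \<Longrightarrow> smooth_map (\<lambda>x. f x - g x)"
  using smooth_map_add[of f "\<lambda>x. - g x"] smooth_map_minus[of g] by simp

lemma smooth_map_sum:
  "finite S \<Longrightarrow> (\<And>j. j \<in> S \<Longrightarrow> smooth_map (f j)) \<Longrightarrow> smooth_map (\<lambda>x. \<Sum>j\<in>S. f j x)"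
  by (simp add: smooth_map_def times_differentiable_sum)

lemma smooth_map_linear: "bounded_linear L \<Longrightarrow> smooth_map L"
  by (simp add: smooth_map_def times_differentiable_linear)

lemma smooth_map_nth: "smooth_map (\<lambda>x :: real ^ 'n. x $ c)"
  by (intro smooth_map_linear bounded_linear_vec_nth)

text \<open>A translation is not linear, so this is not an instance of composition with a linear map.\<close>

lemma smooth_map_shift:
  assumes "smooth_map f"
  shows "smooth_map (\<lambda>x. f (x - a))"
proof -
  have "times_differentiable k f \<Longrightarrow> times_differentiable k (\<lambda>x. f (x - a))" for k
  proof (induction k arbitrary: f)
    case 0
    then show ?case
      using continuous_on_compose2[of UNIV f UNIV "\<lambda>x. x - a"]
      by (simp add: continuous_on_diff continuous_on_id)
  next
    case (Suc k)
    have "((\<lambda>x. x - a) has_derivative (\<lambda>v. v)) (at x)" for x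
      by (auto intro!: derivative_eq_intros)
    moreover have "(f has_derivative frechet_derivative f (at (x - a))) (at (x - a))" for x
      using Suc.prems by (simp add: frechet_derivative_works[symmetric])
    ultimately have d: "((\<lambda>x. f (x - a)) has_derivative frechet_derivative f (at (x - a))) (at x)" for x
      by (rule has_derivative_compose)
    have "times_differentiable k (\<lambda>x. frechet_derivative f (at (x - a)) v)" for v
      using Suc.prems by (intro Suc.IH[where f = "\<lambda>y. frechet_derivative f (at y) v"]) simp
    then show ?case
      using d frechet_derivative_at[OF d, symmetric] by (auto simp: differentiable_def)
  qed
  with assms show ?thesis by (simp add: smooth_map_def)
qed

lemma smooth_map_vec:
  fixes f :: "'a::euclidean_space \<Rightarrow> real ^ 'n"
  assumes "\<And>c. smooth_map (\<lambda>x. f x $ c)"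
  shows "smooth_map f"
proof -
  have "smooth_map (\<lambda>x. f x $ c *\<^sub>R axis c (1::real))" for c
    using assms[of c]
    by (auto simp: smooth_map_def
        intro: times_differentiable_bounded_linear[OF bounded_linear_scaleR_left])
  then have "smooth_map (\<lambda>x. \<Sum>c\<in>UNIV. f x $ c *\<^sub>R axis c (1::real))"
    by (intro smooth_map_sum) auto
  then show ?thesis
    by (simp add: basis_expansion scalar_mult_eq_scaleR[symmetric])
qed

lemma smooth_map_has_derivative:
  "smooth_map f \<Longrightarrow> (f has_derivative frechet_derivative f (at x)) (at x)"
  by (simp add: frechet_derivative_works[symmetric] smooth_map_differentiable)

lemma smooth_map_frechet_derivative:
  "smooth_map f \<Longrightarrow> smooth_map (\<lambda>x. frechet_derivative f (at x) v)"
  unfolding smooth_map_def by (metis times_differentiable.simps(2))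

lemma smooth_map_continuous_on: "smooth_map f \<Longrightarrow> continuous_on S f"
  by (metis continuous_on_subset smooth_map_def subset_UNIV times_differentiable.simps(1))

lemma smooth_map_deriv:
  fixes f :: "real \<Rightarrow> real"
  assumes "smooth_map f"
  shows "smooth_map (deriv f)"
proof -
  have "frechet_derivative f (at x) 1 = deriv f x" for x
    using smooth_map_differentiable[OF assms, of x]
    by (metis DERIV_imp_deriv frechet_derivative_at has_field_derivative_def mult.right_neutral
        real_differentiable_def)
  then show ?thesis
    using smooth_map_frechet_derivative[OF assms, of 1] by simp
qed

lemma smooth_map_higher_deriv:
  fixes f :: "real \<Rightarrow> real"
  shows "smooth_map f \<Longrightarrow> smooth_map ((deriv ^^ m) f)"
  by (induction m) (auto intro: smooth_map_deriv)

lemma smooth_map_higher_deriv_has_derivative: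
  fixes f :: "real \<Rightarrow> real"
  assumes "smooth_map f"
  shows "((deriv ^^ m) f has_real_derivative (deriv ^^ Suc m) f y) (at y)"
  using smooth_map_differentiable[OF smooth_map_higher_deriv[OF assms, of m], of y]
  by (simp add: DERIV_deriv_iff_real_differentiable)

text \<open>
  Differentiation under the integral sign. The derivative has again the form of a weighted average,
  with weight \<open>h s * s\<close> and integrand a directional derivative of \<open>G\<close>, so that smoothness follows by
  induction in \<open>smooth_map_segment_integral\<close>.
\<close>

lemma has_derivative_segment_integral:
  fixes G :: "'a::euclidean_space \<Rightarrow> real"
  assumes G: "smooth_map G" and h: "continuous_on {0..1} h"
  shows "((\<lambda>v. integral {0..1} (\<lambda>s. h s * G (P + s *\<^sub>R v))) has_derivative
    (\<lambda>w. integral {0..1} (\<lambda>s. (h s * s) * frechet_derivative G (at (P + s *\<^sub>R v)) w))) (at v)"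
proof -
  define D where "D x = frechet_derivative G (at x)" for x
  define B where "B x s = Blinfun (\<lambda>w. (h s * s) * D (P + s *\<^sub>R x) w)" for x s
  have GD: "(G has_derivative D x) (at x)" for x
    unfolding D_def by (rule smooth_map_has_derivative[OF G])
  have "bounded_linear (\<lambda>w. (h s * s) * D (P + s *\<^sub>R x) w)" for x s
    by (intro bounded_linear_mult_const bounded_linear_const_mult has_derivative_bounded_linear[OF GD])
  then have B: "blinfun_apply (B x s) w = (h s * s) * D (P + s *\<^sub>R x) w" for x s w
    by (simp add: B_def bounded_linear_Blinfun_apply)
  have cont_D: "continuous_on S (\<lambda>x. D (P + g x *\<^sub>R q x) w)" if "continuous_on S g" "continuous_on S q"
    for S :: "'c::topological_space set" and g q w
    unfolding D_def
    by (rule continuous_on_compose2[OF smooth_map_continuous_on[OF smooth_map_frechet_derivative[OF G], of UNIV w]])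
      (auto intro!: continuous_intros that)
  have cont_h: "continuous_on (UNIV \<times> {0..1}) (\<lambda>z :: 'a \<times> real. h (snd z))"
    by (rule continuous_on_compose2[OF h]) (auto intro!: continuous_intros)
  \<comment> \<open>On a finite-dimensional space, continuity in operator norm reduces to continuity on a basis.\<close>
  have cont_B: "continuous_on (UNIV \<times> cbox 0 1) (\<lambda>(x, s). B x s)"
    unfolding continuous_on_eq_continuous_within
  proof (intro ballI continuous_blinfun_componentwiseI1)
    fix z :: "'a \<times> real" and i :: 'a assume z: "z \<in> UNIV \<times> cbox 0 1"
    have "continuous_on (UNIV \<times> cbox 0 1) (\<lambda>z. (h (snd z) * snd z) * D (P + snd z *\<^sub>R fst z) i)"
      using cont_h by (intro continuous_intros cont_D) auto
    with z have "continuous (at z within UNIV \<times> cbox 0 1)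
        (\<lambda>z. (h (snd z) * snd z) * D (P + snd z *\<^sub>R fst z) i)"
      unfolding continuous_on_eq_continuous_within by blast
    then show "continuous (at z within UNIV \<times> cbox 0 1)
        (\<lambda>z. blinfun_apply (case z of (x, s) \<Rightarrow> B x s) i)"
      by (simp add: case_prod_unfold B)
  qed
  have int: "(\<lambda>s. h s * G (P + s *\<^sub>R x)) integrable_on cbox 0 1" for x
  proof (rule integrable_continuous)
    have "continuous_on (cbox 0 1) (\<lambda>s. G (P + s *\<^sub>R x))"
      by (rule continuous_on_compose2[OF smooth_map_continuous_on[OF G, of UNIV]])
        (auto intro!: continuous_intros)
    with h show "continuous_on (cbox 0 1) (\<lambda>s. h s * G (P + s *\<^sub>R x))"
      by (intro continuous_intros) (simp_all add: cbox_interval)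
  qed
  have inner: "((\<lambda>x. h s * G (P + s *\<^sub>R x)) has_derivative blinfun_apply (B x s)) (at x within UNIV)"
    for x s
  proof -
    have a: "((\<lambda>x. P + s *\<^sub>R x) has_derivative (\<lambda>w. s *\<^sub>R w)) (at x)"
      by (auto intro!: derivative_eq_intros)
    have "((\<lambda>x. h s * G (P + s *\<^sub>R x)) has_derivative (\<lambda>w. h s * D (P + s *\<^sub>R x) (s *\<^sub>R w))) (at x)"
      by (intro has_derivative_mult_right has_derivative_compose[OF a GD])
    moreover have "D (P + s *\<^sub>R x) (s *\<^sub>R w) = s * D (P + s *\<^sub>R x) w" for w
      using linear_cmul[OF has_derivative_linear[OF GD]] by simp
    moreover have "blinfun_apply (B x s) = (\<lambda>w. h s * (s * D (P + s *\<^sub>R x) w))"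
      by (simp add: fun_eq_iff B)
    ultimately show ?thesis
      by simp
  qed
  have "((\<lambda>x. integral (cbox 0 1) (\<lambda>s. h s * G (P + s *\<^sub>R x))) has_derivative
      blinfun_apply (integral (cbox 0 1) (B v))) (at v within UNIV)"
    by (rule leibniz_rule[where fx = B, OF inner int cont_B]) auto
  moreover have "blinfun_apply (integral (cbox 0 1) (B v)) w =
      integral (cbox 0 1) (\<lambda>s. (h s * s) * D (P + s *\<^sub>R v) w)" for w
  proof -
    have "continuous_on (cbox 0 1) (\<lambda>s. case (v, s) of (x, s) \<Rightarrow> B x s)"
      by (rule continuous_on_compose2[OF cont_B]) (auto intro!: continuous_intros)
    then have "B v integrable_on cbox 0 1"
      by (intro integrable_continuous) simp
    from integral_linear[OF this blinfun.bounded_linear_left[of w]] show ?thesis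
      by (simp add: o_def B)
  qed
  ultimately have "((\<lambda>x. integral (cbox 0 1) (\<lambda>s. h s * G (P + s *\<^sub>R x))) has_derivative
      (\<lambda>w. integral (cbox 0 1) (\<lambda>s. (h s * s) * D (P + s *\<^sub>R v) w))) (at v)"
    by (metis (no_types, lifting) has_derivative_eq_rhs HOL.ext)
  then show ?thesis
    by (simp add: D_def cbox_interval)
qed

lemma smooth_map_segment_integral:
  fixes G :: "'a::euclidean_space \<Rightarrow> real"
  assumes "smooth_map G" "continuous_on {0..1} h"
  shows "smooth_map (\<lambda>v. integral {0..1} (\<lambda>s. h s * G (P + s *\<^sub>R v)))"
proof -
  have "times_differentiable k (\<lambda>v. integral {0..1} (\<lambda>s. h s * G (P + s *\<^sub>R v)))" for k
    using assms
  proof (induction k arbitrary: h G)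
    case 0
    then show ?case
      using has_derivative_continuous[OF has_derivative_segment_integral]
      by (auto intro!: continuous_at_imp_continuous_on)
  next
    case (Suc k)
    note d = has_derivative_segment_integral[OF Suc.prems, of P]
    have "times_differentiable k
        (\<lambda>v. integral {0..1} (\<lambda>s. (h s * s) * frechet_derivative G (at (P + s *\<^sub>R v)) w))" for w
      using Suc.prems
      by (intro Suc.IH[where G = "\<lambda>x. frechet_derivative G (at x) w"] smooth_map_frechet_derivative
          continuous_intros)
    then show ?case
      using d frechet_derivative_at[OF d, symmetric] by (auto simp: differentiable_def)
  qed
  then show ?thesis by (simp add: smooth_map_def)
qed

section \<open>Curves with prescribed acceleration\<close>

text \<open>
  The acceleration \<open>q\<close> is a function of time alone, so the two curves differ by a curve of
  acceleration zero.
\<close>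

lemma second_order_unique:
  fixes Q1 Q2 :: "real \<Rightarrow> 'a::real_normed_vector"
  assumes I: "is_interval I" "t0 \<in> I"
    and 1: "\<And>t. t \<in> I \<Longrightarrow> (Q1 has_vector_derivative V1 t) (at t)"
      "\<And>t. t \<in> I \<Longrightarrow> (V1 has_vector_derivative q t) (at t)"
    and 2: "\<And>t. t \<in> I \<Longrightarrow> (Q2 has_vector_derivative V2 t) (at t)"
      "\<And>t. t \<in> I \<Longrightarrow> (V2 has_vector_derivative q t) (at t)"
    and init: "Q1 t0 = Q2 t0" "V1 t0 = V2 t0"
    and t: "t \<in> I"
  shows "Q1 t = Q2 t" "V1 t = V2 t"
proof -
  have conv: "convex I" using I(1) by (simp add: is_interval_convex)
  have V: "V1 s = V2 s" if "s \<in> I" for s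
  proof -
    obtain c where c: "\<And>s. s \<in> I \<Longrightarrow> V1 s - V2 s = c"
    proof (rule has_vector_derivative_zero_constant[OF conv, of "\<lambda>s. V1 s - V2 s"])
      fix s assume s: "s \<in> I"
      show "((\<lambda>s. V1 s - V2 s) has_vector_derivative 0) (at s within I)"
        using has_vector_derivative_diff[OF 1(2)[OF s] 2(2)[OF s]]
        by (auto intro: has_vector_derivative_at_within)
    qed blast
    show ?thesis using c[OF that] c[OF I(2)] init by simp
  qed
  then show "V1 t = V2 t" using t .
  obtain c where c: "\<And>s. s \<in> I \<Longrightarrow> Q1 s - Q2 s = c"
  proof (rule has_vector_derivative_zero_constant[OF conv, of "\<lambda>s. Q1 s - Q2 s"])
    fix s assume s: "s \<in> I"
    show "((\<lambda>s. Q1 s - Q2 s) has_vector_derivative 0) (at s within I)"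
      using has_vector_derivative_diff[OF 1(1)[OF s] 2(1)[OF s]] V[OF s]
      by (auto intro: has_vector_derivative_at_within)
  qed blast
  show "Q1 t = Q2 t" using c[OF t] c[OF I(2)] init by simp
qed

lemma second_order_exists:
  fixes q :: "real \<Rightarrow> 'a::euclidean_space"
  assumes "continuous_on UNIV q"
  obtains Q V where "Q t0 = a" "V t0 = b"
    "\<And>t. (Q has_vector_derivative V t) (at t)" "\<And>t. (V has_vector_derivative q t) (at t)"
proof -
  have anti: "\<exists>F. F t0 = c \<and> (\<forall>t. (F has_vector_derivative g t) (at t))"
    if "continuous_on UNIV g" for g :: "real \<Rightarrow> 'a" and c
  proof -
    have "isCont g x" for x
      using that by (simp add: continuous_on_eq_continuous_at)
    then have "\<exists>F. \<forall>x::real. -\<infinity> < ereal x \<longrightarrow> ereal x < \<infinity> \<longrightarrow> (F has_vector_derivative g x) (at x)"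
      by (intro einterval_antiderivative) auto
    then obtain F where F: "\<And>x. (F has_vector_derivative g x) (at x)"
      by auto
    have "((\<lambda>t. F t - F t0 + c) has_vector_derivative g t) (at t)" for t
      using F by (auto intro!: derivative_eq_intros)
    then show ?thesis by (intro exI[of _ "\<lambda>t. F t - F t0 + c"]) simp
  qed
  obtain V where V: "V t0 = b" "\<And>t. (V has_vector_derivative q t) (at t)"
    using anti[OF assms] by blast
  have "continuous_on UNIV V"
    using V(2) by (intro continuous_at_imp_continuous_on) (auto intro: has_vector_derivative_continuous)
  then obtain Q where "Q t0 = a" "\<And>t. (Q has_vector_derivative V t) (at t)"
    using anti by blast
  with V that show ?thesis by blast
qed

text \<open>
  Taylor's formula with integral remainder: the integrand is the derivative of
  \<open>(1 - s) *\<^sub>R V s + Q s\<close>.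
\<close>

lemma second_order_Taylor:
  fixes Q :: "real \<Rightarrow> 'a::euclidean_space"
  assumes "\<And>t. t \<in> {0..1} \<Longrightarrow> (Q has_vector_derivative V t) (at t)"
    and "\<And>t. t \<in> {0..1} \<Longrightarrow> (V has_vector_derivative q t) (at t)"
  shows "Q 1 = Q 0 + V 0 + integral {0..1} (\<lambda>s. (1 - s) *\<^sub>R q s)"
proof -
  have "((\<lambda>s. (1 - s) *\<^sub>R V s + Q s) has_vector_derivative (1 - s) *\<^sub>R q s) (at s within {0..1})"
    if "s \<in> {0..1}" for s
    using assms[OF that]
    by (auto intro!: derivative_eq_intros intro: has_vector_derivative_at_within
        simp: has_vector_derivative_at_within)
  from fundamental_theorem_of_calculus[OF _ this]
  have "((\<lambda>s. (1 - s) *\<^sub>R q s) has_integral (Q 1 - (V 0 + Q 0))) {0..1}" by simp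
  from integral_unique[OF this] show ?thesis by (simp add: algebra_simps)
qed

section \<open>Symmetric products and the Kulkarni-Nomizu product\<close>

text \<open>
  The \<open>m\<close>-th derivative of \<open>y \<mapsto> y ^ n\<close>.
\<close>

definition power_deriv :: "nat \<Rightarrow> nat \<Rightarrow> real \<Rightarrow> real" where
  "power_deriv n m y = (if m \<le> n then fact n / fact (n - m) * y ^ (n - m) else 0)"

lemma power_deriv_0: "power_deriv n 0 y = y ^ n"
  by (simp add: power_deriv_def)

lemma power_deriv_self: "power_deriv n n y = fact n"
  by (simp add: power_deriv_def)

lemma power_deriv_eq_0: "n < m \<Longrightarrow> power_deriv n m y = 0"
  by (simp add: power_deriv_def)

lemma power_deriv_has_derivative:
  "(power_deriv n m has_real_derivative power_deriv n (Suc m) y) (at y)"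
proof (cases "m < n")
  case True
  then obtain d where n: "n = Suc (m + d)" using less_imp_Suc_add by blast
  have "((\<lambda>y. fact n / fact (Suc d) * y ^ Suc d) has_real_derivative
      fact n / fact (Suc d) * (real (Suc d) * y ^ d)) (at y)"
    by (intro DERIV_cmult) (use DERIV_pow[of "Suc d" y] in simp)
  moreover have "fact n / fact (Suc d) * (real (Suc d) * y ^ d) = fact n / fact d * y ^ d"
    by (simp add: divide_simps del: of_nat_Suc)
  ultimately show ?thesis
    by (simp add: power_deriv_def[abs_def] n del: fact_Suc of_nat_Suc power_Suc)
next
  case False
  then have "power_deriv n m = (\<lambda>y. power_deriv n m 0)"
    by (auto simp: power_deriv_def fun_eq_iff)
  then have "(power_deriv n m has_real_derivative 0) (at y)"
    by (metis DERIV_const)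
  with False show ?thesis by (simp add: power_deriv_eq_0)
qed

definition y_product :: "(real ^ 'i::finite coord) list \<Rightarrow> real" where
  "y_product as = (\<Prod>a\<leftarrow>as. a $ Y)"

text \<open>
  The value \<open>\<Sum>\<^sub>i l(a\<^sub>i) \<Prod>\<^bsub>j\<noteq>i\<^esub> y(a\<^sub>j)\<close> of the symmetric product of the linear form \<open>l\<close> with
  copies of \<open>dy\<close>.
\<close>

primrec one_slot_sum :: "(real ^ 'i::finite coord \<Rightarrow> real) \<Rightarrow> (real ^ 'i coord) list \<Rightarrow> real" where
  "one_slot_sum l [] = 0"
| "one_slot_sum l (a # as) = l a * y_product as + a $ Y * one_slot_sum l as"

lemma y_product_Nil [simp]: "y_product [] = 1"
  by (simp add: y_product_def)

lemma y_product_Cons [simp]: "y_product (a # as) = a $ Y * y_product as"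
  by (simp add: y_product_def)

lemma y_product_append: "y_product (as @ bs) = y_product as * y_product bs"
  by (simp add: y_product_def)

lemma one_slot_sum_snoc:
  "one_slot_sum l (as @ [b]) = one_slot_sum l as * b $ Y + y_product as * l b"
  by (induction as) (simp_all add: y_product_append algebra_simps)

lemma one_slot_sum_has_derivative:
  assumes "\<And>a. ((\<lambda>P. l P a) has_derivative l' a) (at P)"
  shows "((\<lambda>P. one_slot_sum (l P) as) has_derivative (\<lambda>\<eta>. one_slot_sum (\<lambda>a. l' a \<eta>) as)) (at P)"
proof (induction as)
  case (Cons a as)
  show ?case
    using has_derivative_add[OF has_derivative_mult_left[OF assms] has_derivative_mult_right[OF Cons]]
    by simp
qed simp

lemma one_slot_sum_mult_right: "one_slot_sum (\<lambda>a. l a * c) as = one_slot_sum l as * c"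
  by (induction as) (simp_all add: algebra_simps)

lemma one_slot_sum_add: "one_slot_sum (\<lambda>a. l a + m a) as = one_slot_sum l as + one_slot_sum m as"
  by (induction as) (simp_all add: algebra_simps)

lemma one_slot_sum_y: "one_slot_sum (\<lambda>a. a $ Y) as = length as * y_product as"
  by (induction as) (simp_all add: algebra_simps)

text \<open>
  The Kulkarni-Nomizu product of \<open>dx\<^sup>2\<close> with \<open>S\<close>, where the last arguments \<open>es\<close> of \<open>S\<close> are carried along
  as derivative slots.
\<close>

definition kulkarni_nomizu :: "((real ^ 'i::finite coord) list \<Rightarrow> real) \<Rightarrow> (real ^ 'i coord) list \<Rightarrow> real" where
  "kulkarni_nomizu S vs = (case vs of u # v # w # t # es \<Rightarrow>
      S (v # w # es) * (u $ X * t $ X) - S (u # w # es) * (v $ X * t $ X)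
    + S (u # t # es) * (v $ X * w $ X) - S (v # t # es) * (u $ X * w $ X)
    | _ \<Rightarrow> 0)"

lemma kulkarni_nomizu_Cons [simp]:
  "kulkarni_nomizu S (u # v # w # t # es) =
      S (v # w # es) * (u $ X * t $ X) - S (u # w # es) * (v $ X * t $ X)
    + S (u # t # es) * (v $ X * w $ X) - S (v # t # es) * (u $ X * w $ X)"
  by (simp add: kulkarni_nomizu_def)

lemma length_4_plus:
  assumes "length vs = 4 + k"
  obtains u v w t es where "vs = u # v # w # t # es" "length es = k"
  using assms by (auto simp: length_Suc_conv numeral_eq_Suc)

section \<open>The derivatives of the potential\<close>

locale potential_family =
  fixes p :: nat and f :: "real \<Rightarrow> real" and idx :: "nat \<Rightarrow> 'i::finite"
  assumes smooth_f: "smooth_map f"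
begin

abbreviation "g \<equiv> neutral_metric p f idx"

text \<open>
  The \<open>n\<close>-th derivative of the potential, as a symmetric form, is \<open>jet n\<close>. As the potential is affine
  in \<open>z\<close>, at most one of the \<open>n\<close> directions can contribute through its \<open>z\<close>-components: \<open>y_jet n\<close> is
  the coefficient of \<open>dy\<^sup>n\<close>, and the linear form \<open>z_jet (n - 1)\<close> in \<open>dz\<close> accompanies
  \<open>dy\<^bsup>n-1\<^esup>\<close>.
\<close>

definition y_jet :: "nat \<Rightarrow> real ^ 'i coord \<Rightarrow> real" where
  "y_jet m P = (deriv ^^ m) f (P $ Y) + (\<Sum>j\<le>p. power_deriv (j + 1) m (P $ Y) * P $ Z (idx j))"

definition z_jet :: "nat \<Rightarrow> real ^ 'i coord \<Rightarrow> real ^ 'i coord \<Rightarrow> real" where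
  "z_jet m P a = (\<Sum>j\<le>p. power_deriv (j + 1) m (P $ Y) * a $ Z (idx j))"

definition jet :: "nat \<Rightarrow> real ^ 'i coord \<Rightarrow> (real ^ 'i coord) list \<Rightarrow> real" where
  "jet n P as = y_jet n P * y_product as + one_slot_sum (z_jet (n - 1) P) as"

lemma potential_eq_y_jet: "potential p f idx P = y_jet 0 P"
  by (simp add: potential_def y_jet_def power_deriv_0)

lemma has_derivative_of_y:
  fixes P :: "real ^ 'i coord"
  assumes "(h has_real_derivative d) (at (P $ Y))"
  shows "((\<lambda>P. h (P $ Y)) has_derivative (\<lambda>\<eta>. d * \<eta> $ Y)) (at P)"
  using has_derivative_compose[OF bounded_linear_imp_has_derivative[OF bounded_linear_vec_nth]
      assms[unfolded has_field_derivative_def]]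
  by simp

lemma y_jet_has_derivative:
  "(y_jet m has_derivative (\<lambda>\<eta>. y_jet (Suc m) P * \<eta> $ Y + z_jet m P \<eta>)) (at P)"
proof -
  have "((\<lambda>P. (deriv ^^ m) f (P $ Y) + (\<Sum>j\<le>p. power_deriv (j + 1) m (P $ Y) * P $ Z (idx j)))
      has_derivative (\<lambda>\<eta>. (deriv ^^ Suc m) f (P $ Y) * \<eta> $ Y +
        (\<Sum>j\<le>p. power_deriv (j + 1) m (P $ Y) * \<eta> $ Z (idx j)
          + power_deriv (j + 1) (Suc m) (P $ Y) * \<eta> $ Y * P $ Z (idx j)))) (at P)"
    by (intro has_derivative_add has_derivative_sum has_derivative_mult has_derivative_of_y
        smooth_map_higher_deriv_has_derivative smooth_f power_deriv_has_derivative
        bounded_linear_imp_has_derivative bounded_linear_vec_nth)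
  then show ?thesis
    unfolding y_jet_def z_jet_def
    by (simp add: algebra_simps sum.distrib sum_distrib_left)
qed

lemma z_jet_has_derivative:
  "((\<lambda>P. z_jet m P a) has_derivative (\<lambda>\<eta>. z_jet (Suc m) P a * \<eta> $ Y)) (at P)"
proof -
  have "((\<lambda>P. \<Sum>j\<le>p. power_deriv (j + 1) m (P $ Y) * a $ Z (idx j)) has_derivative
      (\<lambda>\<eta>. \<Sum>j\<le>p. power_deriv (j + 1) (Suc m) (P $ Y) * \<eta> $ Y * a $ Z (idx j))) (at P)"
    by (intro has_derivative_sum has_derivative_mult_left has_derivative_of_y power_deriv_has_derivative)
  then show ?thesis
    unfolding z_jet_def by (simp add: algebra_simps sum_distrib_left)
qed

text \<open>
  The differential of \<open>y_jet n\<close> supplies \<open>y_jet (Suc n)\<close> and the term whose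
  \<open>z\<close>-slot is the new direction; the differential of \<open>z_jet (n - 1)\<close> supplies the terms whose
  \<open>z\<close>-slot is an old one. For \<open>n = 0\<close> the truncated index \<open>n - 1\<close> would break this.
\<close>

lemma jet_has_derivative:
  assumes "n > 0"
  shows "((\<lambda>P. jet n P as) has_derivative (\<lambda>\<eta>. jet (Suc n) P (as @ [\<eta>]))) (at P)"
proof -
  have "((\<lambda>P. y_jet n P * y_product as + one_slot_sum (z_jet (n - 1) P) as) has_derivative
    (\<lambda>\<eta>. (y_jet (Suc n) P * \<eta> $ Y + z_jet n P \<eta>) * y_product as
      + one_slot_sum (\<lambda>a. z_jet (Suc (n - 1)) P a * \<eta> $ Y) as)) (at P)"
    by (intro has_derivative_add has_derivative_mult_left y_jet_has_derivative
        one_slot_sum_has_derivative z_jet_has_derivative)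
  then show ?thesis
    using assms
    by (simp add: jet_def y_product_append one_slot_sum_snoc one_slot_sum_mult_right)
      (simp add: algebra_simps)
qed

lemma potential_has_derivative: "(potential p f idx has_derivative (\<lambda>\<eta>. jet 1 P [\<eta>])) (at P)"
  using y_jet_has_derivative[of 0 P]
  by (simp add: jet_def potential_eq_y_jet[abs_def])

text \<open>
  This recovers the linear form from its values on the coordinate fields, which is how it enters the
  barred components of the connection.
\<close>

lemma z_jet_expand: "(\<Sum>j\<in>UNIV. z_jet m P (axis (Z j) 1) * e $ Z j) = z_jet m P e"
proof -
  have "(\<Sum>j\<in>UNIV. z_jet m P (axis (Z j) 1) * e $ Z j) =
      (\<Sum>i\<le>p. \<Sum>j\<in>UNIV. power_deriv (i + 1) m (P $ Y) * (if j = idx i then e $ Z j else 0))"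
    unfolding z_jet_def sum_distrib_right
    by (subst sum.swap) (auto simp: axis_def intro!: sum.cong)
  also have "\<dots> = z_jet m P e"
    by (simp add: z_jet_def sum_distrib_left[symmetric])
  finally show ?thesis .
qed

lemma z_jet_other: "(\<And>j. a $ Z j = 0) \<Longrightarrow> z_jet m P a = 0"
  by (simp add: z_jet_def)

section \<open>The Levi-Civita connection and the curvature\<close>

text \<open>
  The Christoffel symbols solved from the Koszul formula: the barred components pair with the base
  components, and the first derivative of the potential is the only input.
\<close>

definition connection :: "real ^ 'i coord \<Rightarrow> real ^ 'i coord \<Rightarrow> real ^ 'i coord \<Rightarrow> real ^ 'i coord" where
  "connection P u v = (\<chi> c. case c of
      Xb \<Rightarrow> - jet 1 P [u] * v $ X - jet 1 P [v] * u $ X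
    | Yb \<Rightarrow> jet 1 P [axis Y 1] * (u $ X * v $ X)
    | Zb j \<Rightarrow> jet 1 P [axis (Z j) 1] * (u $ X * v $ X)
    | _ \<Rightarrow> 0)"

lemma connection_nth [simp]:
  "connection P u v $ X = 0" "connection P u v $ Y = 0" "connection P u v $ Z j = 0"
  "connection P u v $ Xb = - jet 1 P [u] * v $ X - jet 1 P [v] * u $ X"
  "connection P u v $ Yb = jet 1 P [axis Y 1] * (u $ X * v $ X)"
  "connection P u v $ Zb j = jet 1 P [axis (Z j) 1] * (u $ X * v $ X)"
  by (simp_all add: connection_def)

lemma metric_connection:
  "g P (connection P u v) e =
    jet 1 P [e] * (u $ X * v $ X) - jet 1 P [u] * (v $ X * e $ X) - jet 1 P [v] * (u $ X * e $ X)"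
proof -
  have "jet 1 P [e] = jet 1 P [axis Y 1] * e $ Y + (\<Sum>j\<in>UNIV. jet 1 P [axis (Z j) 1] * e $ Z j)"
    using z_jet_expand[of 0 P e] by (simp add: jet_def z_jet_other axis_def)
  then show ?thesis
    by (simp add: neutral_metric_def flat_form_def algebra_simps sum_distrib_left)
qed

lemma metric_frechet_derivative:
  "frechet_derivative (\<lambda>Q. g Q a b) (at P) \<eta> = - 2 * jet 1 P [\<eta>] * (a $ X * b $ X)"
proof -
  have "((\<lambda>Q. flat_form a b - 2 * potential p f idx Q * a $ X * b $ X) has_derivative
      (\<lambda>\<eta>. 0 - 2 * jet 1 P [\<eta>] * a $ X * b $ X)) (at P)"
    by (intro has_derivative_diff has_derivative_const has_derivative_mult_left
        has_derivative_mult_right potential_has_derivative)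
  then have "((\<lambda>Q. g Q a b) has_derivative (\<lambda>\<eta>. - 2 * jet 1 P [\<eta>] * (a $ X * b $ X))) (at P)"
    by (simp add: neutral_metric_def mult.assoc)
  from frechet_derivative_at[OF this, symmetric] show ?thesis by simp
qed

text \<open>
  Both sides have the same metric products with all vectors, and the metric is non-degenerate.
\<close>

lemma christoffel_eq_connection: "christoffel g P u v = connection P u v"
proof -
  have ip: "inner_product_form (g P)" by (rule inner_product_form_metric)
  have "2 * g P (christoffel g P u v) e = 2 * g P (connection P u v) e" for e
    unfolding christoffel_Koszul[OF pseudo_riemannian_metric[OF smooth_f]]
    by (simp add: metric_frechet_derivative metric_connection algebra_simps)
  moreover have "linear (\<lambda>w. g P w e)" for e
  proof -
    have "(\<lambda>w. g P w e) = g P e" using ip by (auto simp: inner_product_form_def)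
    with ip show ?thesis by (simp add: inner_product_form_def)
  qed
  ultimately have "g P (christoffel g P u v - connection P u v) e = 0" for e
    using linear_diff[of "\<lambda>w. g P w e" "christoffel g P u v" "connection P u v"] by simp
  with ip have "christoffel g P u v - connection P u v = 0"
    unfolding inner_product_form_def by blast
  then show ?thesis by simp
qed

text \<open>
  The connection vanishes on vectors without base components, in particular on its own values. This
  removes the quadratic terms in the curvature.
\<close>

lemma connection_vertical:
  assumes "w $ X = 0" "w $ Y = 0" "\<And>j. w $ Z j = 0"
  shows "connection P u w = 0"
proof -
  have "connection P u w $ c = 0" for c
    using assms by (cases c) (simp_all add: jet_def z_jet_other)
  then show ?thesis by (simp add: vec_eq_iff)
qed

lemma connection_zero_left: "connection P 0 v = 0"
proof -
  have "connection P 0 v $ c = 0" for c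
    by (cases c) (simp_all add: jet_def z_jet_other)
  then show ?thesis by (simp add: vec_eq_iff)
qed

definition connection_deriv ::
    "real ^ 'i coord \<Rightarrow> real ^ 'i coord \<Rightarrow> real ^ 'i coord \<Rightarrow> real ^ 'i coord \<Rightarrow> real ^ 'i coord" where
  "connection_deriv P u v \<eta> = (\<chi> c. case c of
      Xb \<Rightarrow> - jet 2 P [u, \<eta>] * v $ X - jet 2 P [v, \<eta>] * u $ X
    | Yb \<Rightarrow> jet 2 P [axis Y 1, \<eta>] * (u $ X * v $ X)
    | Zb j \<Rightarrow> jet 2 P [axis (Z j) 1, \<eta>] * (u $ X * v $ X)
    | _ \<Rightarrow> 0)"

lemma vec_has_derivative:
  fixes F :: "'a::real_normed_vector \<Rightarrow> real ^ 'n"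
  assumes "\<And>c. ((\<lambda>x. F x $ c) has_derivative (\<lambda>v. F' v $ c)) (at x)"
  shows "(F has_derivative F') (at x)"
  by (subst has_derivative_componentwise_within)
    (use assms in \<open>auto simp: Basis_vec_def inner_axis\<close>)

lemma connection_has_derivative: "((\<lambda>P. connection P u v) has_derivative connection_deriv P u v) (at P)"
proof (rule vec_has_derivative)
  fix c :: "'i coord"
  have jet: "((\<lambda>P. jet 1 P [a]) has_derivative (\<lambda>\<eta>. jet 2 P [a, \<eta>])) (at P)" for a
    using jet_has_derivative[of 1 "[a]" P] by (simp add: numeral_2_eq_2)
  show "((\<lambda>P. connection P u v $ c) has_derivative (\<lambda>\<eta>. connection_deriv P u v \<eta> $ c)) (at P)"
    by (cases c) (auto simp: connection_deriv_def
        intro!: has_derivative_minus has_derivative_diff has_derivative_mult_left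
        jet[unfolded One_nat_def])
qed

lemma metric_connection_deriv:
  "g P (connection_deriv P u v \<eta>) e =
    jet 2 P [e, \<eta>] * (u $ X * v $ X) - jet 2 P [u, \<eta>] * (v $ X * e $ X) - jet 2 P [v, \<eta>] * (u $ X * e $ X)"
proof -
  have "jet 2 P [e, \<eta>] = jet 2 P [axis Y 1, \<eta>] * e $ Y + (\<Sum>j\<in>UNIV. jet 2 P [axis (Z j) 1, \<eta>] * e $ Z j)"
    using z_jet_expand[of 1 P e, symmetric]
    by (simp add: jet_def z_jet_other axis_def algebra_simps sum_distrib_left)
  then show ?thesis
    by (simp add: neutral_metric_def flat_form_def connection_deriv_def algebra_simps sum_distrib_left)
qed

lemma jet_swap: "jet n P (a # b # as) = jet n P (b # a # as)"
  by (simp add: jet_def algebra_simps)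

text \<open>
  Only the derivatives of the connection survive; each contributes two terms of the
  Kulkarni-Nomizu product, and two further terms cancel by the symmetry of the second derivative.
\<close>

lemma curvature_tensor_eq:
  "curvature_tensor g P u v w t = kulkarni_nomizu (jet 2 P) [u, v, w, t]"
proof -
  have nabla_const: "nabla g (\<lambda>_. a) (\<lambda>_. b) = (\<lambda>Q. connection Q a b)" for a b
    by (simp add: nabla_def christoffel_eq_connection)
  have "nabla g (\<lambda>_. a) (\<lambda>Q. connection Q b c) P = connection_deriv P b c a" for a b c
    using frechet_derivative_at[OF connection_has_derivative[of b c P], symmetric]
    by (simp add: nabla_def christoffel_eq_connection connection_vertical)
  moreover have "lie_bracket (\<lambda>_. u) (\<lambda>_. v) = (\<lambda>_. 0)"
    by (simp add: lie_bracket_def)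
  ultimately have "curvature_operator g (\<lambda>_. u) (\<lambda>_. v) (\<lambda>_. w) P =
      connection_deriv P v w u - connection_deriv P u w v"
    by (simp add: curvature_operator_def nabla_const connection_zero_left)
  moreover have "g P (a - b) t = g P a t - g P b t" for a b
    by (simp add: neutral_metric_def flat_form_def algebra_simps sum_subtractf sum.distrib)
  ultimately have "curvature_tensor g P u v w t = g P (connection_deriv P v w u) t - g P (connection_deriv P u w v) t"
    by (simp add: curvature_tensor_def)
  then show ?thesis
    by (simp add: metric_connection_deriv algebra_simps jet_swap)
qed

lemma jet_vertical:
  assumes "a \<in> set as" "a $ Y = 0" "\<And>j. a $ Z j = 0"
  shows "jet n P as = 0"
proof -
  have y: "y_product bs = 0" if "a \<in> set bs" for bs
    using that assms(2) by (auto simp: y_product_def prod_list_zero_iff)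
  have "one_slot_sum (z_jet m P) as = 0" for m
    using assms(1) by (induction as) (auto simp: y z_jet_other assms)
  with y[OF assms(1)] show ?thesis by (simp add: jet_def)
qed

text \<open>
  This removes the correction terms of the covariant derivative, which insert values of the
  connection into one slot.
\<close>

lemma kulkarni_nomizu_jet_vertical:
  assumes "length vs = 4 + k" "i < 4 + k" "a $ X = 0" "a $ Y = 0" "\<And>j. a $ Z j = 0"
  shows "kulkarni_nomizu (jet n P) (vs[i := a]) = 0"
proof -
  obtain u v w t es where vs: "vs = u # v # w # t # es" "length es = k"
    using length_4_plus[OF assms(1)] .
  consider "i = 0" | "i = 1" | "i = 2" | "i = 3" | j where "i = Suc (Suc (Suc (Suc j)))" "j < k"
    using assms(2) by (auto simp: numeral_eq_Suc) (metis One_nat_def not0_implies_Suc Suc_less_eq add_Suc)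
  then show ?thesis
  proof cases
    case (5 j)
    then have "a \<in> set (es[j := a])" using vs by (simp add: set_update_memI)
    then have "jet n P (b # c # es[j := a]) = 0" for b c
      by (intro jet_vertical[of a]) (auto simp: assms)
    with vs 5 show ?thesis by simp
  qed (use vs in \<open>simp_all add: assms jet_vertical[of a] numeral_eq_Suc\<close>)
qed

text \<open>
  All correction terms vanish, so covariant differentiation is differentiation of the coefficients,
  which appends one more direction to the jet.
\<close>

lemma nabla_curvature_eq:
  "length vs = 4 + k \<Longrightarrow> nabla_curvature g k P vs = kulkarni_nomizu (jet (k + 2) P) vs"
proof (induction k arbitrary: P vs)
  case 0
  then obtain u v w t where "vs = [u, v, w, t]"
    using length_4_plus[OF 0] by (metis length_0_conv)
  then show ?case by (simp add: curvature_tensor_eq numeral_eq_Suc)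
next
  case (Suc k)
  define ws where "ws = butlast vs"
  define \<eta> where "\<eta> = last vs"
  have "vs \<noteq> []" using Suc.prems by auto
  then have vs: "vs = ws @ [\<eta>]" and ws: "length ws = 4 + k"
    using Suc.prems by (auto simp: ws_def \<eta>_def)
  obtain a b c d es where abcd: "ws = a # b # c # d # es" "length es = k"
    using length_4_plus[OF ws] .
  have "nabla_curvature g k P (ws[i := christoffel g P \<eta> (ws ! i)]) = 0" if "i < 4 + k" for i
    using that ws by (simp add: Suc.IH kulkarni_nomizu_jet_vertical christoffel_eq_connection)
  moreover have "((\<lambda>Q. nabla_curvature g k Q ws) has_derivative
      (\<lambda>\<eta>. kulkarni_nomizu (jet (Suc k + 2) P) (ws @ [\<eta>]))) (at P)"
  proof -
    have j: "((\<lambda>Q. jet (k + 2) Q (x # y # es) * r) has_derivative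
        (\<lambda>\<eta>. jet (Suc k + 2) P (x # y # es @ [\<eta>]) * r)) (at P)" for x y r
      using jet_has_derivative[of "k + 2" "x # y # es" P] by (intro has_derivative_mult_left) simp
    have "((\<lambda>Q. kulkarni_nomizu (jet (k + 2) Q) ws) has_derivative
      (\<lambda>\<eta>. kulkarni_nomizu (jet (Suc k + 2) P) (ws @ [\<eta>]))) (at P)"
      unfolding abcd append_Cons kulkarni_nomizu_Cons
      by (intro has_derivative_add has_derivative_diff j)
    with ws show ?thesis by (simp add: Suc.IH)
  qed
  from frechet_derivative_at[OF this, symmetric] ws show ?case
    using calculation by (simp add: covariant_derivative_def ws_def[symmetric] \<eta>_def[symmetric] vs[symmetric])
qed

section \<open>Geodesics and the exponential map\<close>

text \<open>
  Agreement of the components without a bar, on which alone the connection depends.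
\<close>

definition base_eq :: "real ^ 'i coord \<Rightarrow> real ^ 'i coord \<Rightarrow> bool" where
  "base_eq P Q \<longleftrightarrow> P $ X = Q $ X \<and> P $ Y = Q $ Y \<and> (\<forall>j. P $ Z j = Q $ Z j)"

lemma connection_base_cong:
  assumes "base_eq P P'" "base_eq u u'"
  shows "connection P u u = connection P' u' u'"
proof -
  have jet: "jet 1 P [a] = jet 1 P' [b]" if "a $ Y = b $ Y" "\<And>j. a $ Z j = b $ Z j" for a b
    using assms(1) that by (simp add: jet_def y_jet_def z_jet_def base_eq_def)
  have "connection P u u $ c = connection P' u' u' $ c" for c
    using assms(2) jet[of u u'] jet[of a a for a] by (cases c) (simp_all add: base_eq_def)
  then show ?thesis by (simp add: vec_eq_iff)
qed

text \<open>
  A curve whose acceleration has no base components moves on a straight line as far as its base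
  components are concerned. The curve need not be a geodesic here: the statement is also used to
  show that the curve constructed in \<open>geodesic_exists\<close> is one.
\<close>

lemma base_straight:
  assumes I: "is_interval I" "t0 \<in> I"
    and \<gamma>: "\<And>t. t \<in> I \<Longrightarrow> (\<gamma> has_vector_derivative V t) (at t)"
      "\<And>t. t \<in> I \<Longrightarrow> (V has_vector_derivative q t) (at t)"
    and q: "\<And>t. t \<in> I \<Longrightarrow> base_eq (q t) 0"
    and t: "t \<in> I"
  shows "base_eq (\<gamma> t) (\<gamma> t0 + (t - t0) *\<^sub>R V t0) \<and> base_eq (V t) (V t0)"
proof -
  have *: "\<gamma> t $ c = (\<gamma> t0 + (t - t0) *\<^sub>R V t0) $ c \<and> V t $ c = V t0 $ c"
    if c: "\<And>t. t \<in> I \<Longrightarrow> q t $ c = 0" for c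
  proof -
    note nth = bounded_linear.has_vector_derivative[OF bounded_linear_vec_nth]
    have 1: "((\<lambda>t. \<gamma> t $ c) has_vector_derivative V t $ c) (at t)"
      "((\<lambda>t. V t $ c) has_vector_derivative 0) (at t)" if "t \<in> I" for t
      using nth[OF \<gamma>(1)[OF that]] nth[OF \<gamma>(2)[OF that], of c] c[OF that] by simp_all
    have 2: "((\<lambda>t. (\<gamma> t0 + (t - t0) *\<^sub>R V t0) $ c) has_vector_derivative V t0 $ c) (at t)"
      "((\<lambda>t. V t0 $ c) has_vector_derivative 0) (at t)" for t
      by (auto intro!: derivative_eq_intros simp: has_real_derivative_iff_has_vector_derivative[symmetric])
    show ?thesis
      using second_order_unique[OF I 1 2 _ _ t] by simp
  qed
  show ?thesis
    using q unfolding base_eq_def by (auto simp del: vector_add_component intro!: *[THEN conjunct1] *[THEN conjunct2])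
qed

lemma base_eq_connection: "base_eq (- connection P u v) 0"
  by (simp add: base_eq_def)

text \<open>
  The geodesic equation decouples: by \<open>base_straight\<close> the unknown curve may be replaced by its
  tangent line in the right-hand side, which becomes an explicit function of time.
\<close>

lemma geodesic_acceleration:
  assumes I: "is_interval I" "t0 \<in> I"
    and \<gamma>: "\<And>t. t \<in> I \<Longrightarrow> (\<gamma> has_vector_derivative V t) (at t)"
      "\<And>t. t \<in> I \<Longrightarrow> (V has_vector_derivative - connection (\<gamma> t) (V t) (V t)) (at t)"
    and t: "t \<in> I"
  shows "(V has_vector_derivative - connection (\<gamma> t0 + (t - t0) *\<^sub>R V t0) (V t0) (V t0)) (at t)"
  using \<gamma>(2)[OF t] base_straight[OF I \<gamma> base_eq_connection t] connection_base_cong by metis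

lemma connection_along_line_continuous: "continuous_on UNIV (\<lambda>t. connection (P + (t - t0) *\<^sub>R v) v v)"
proof -
  have "continuous_on UNIV (\<lambda>Q. connection Q v v)"
    using has_derivative_continuous[OF connection_has_derivative]
    by (intro continuous_at_imp_continuous_on) blast
  then show ?thesis
    by (rule continuous_on_compose2) (auto intro!: continuous_intros)
qed

lemma geodesic_exists:
  obtains \<sigma> V where "\<sigma> t0 = P" "V t0 = v"
    "\<And>t. (\<sigma> has_vector_derivative V t) (at t)"
    "\<And>t. (V has_vector_derivative - connection (\<sigma> t) (V t) (V t)) (at t)"
proof -
  obtain \<sigma> V where *: "\<sigma> t0 = P" "V t0 = v"
    "\<And>t. (\<sigma> has_vector_derivative V t) (at t)"
    "\<And>t. (V has_vector_derivative - connection (P + (t - t0) *\<^sub>R v) v v) (at t)"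
    using second_order_exists[OF continuous_on_minus[OF connection_along_line_continuous]] by metis
  have "base_eq (\<sigma> t) (P + (t - t0) *\<^sub>R v) \<and> base_eq (V t) v" for t
    using base_straight[of UNIV t0 \<sigma> V _ t, OF _ _ *(3,4) base_eq_connection] *(1,2)
    by (simp add: is_interval_univ)
  then have "connection (\<sigma> t) (V t) (V t) = connection (P + (t - t0) *\<^sub>R v) v v" for t
    using connection_base_cong by blast
  with * that show ?thesis by metis
qed

lemma geodesic_on_UNIV:
  assumes "\<And>t. (\<sigma> has_vector_derivative V t) (at t)"
    "\<And>t. (V has_vector_derivative - connection (\<sigma> t) (V t) (V t)) (at t)"
  shows "geodesic_on g UNIV \<sigma>"
  using assms by (auto simp: geodesic_on_def christoffel_eq_connection is_interval_univ)

lemma metric_complete: "geodesically_complete g"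
  unfolding geodesically_complete_def
proof (intro allI impI)
  fix I \<gamma> assume "geodesic_on g I \<gamma>"
  then obtain V where I: "is_interval I"
    and \<gamma>: "\<And>t. t \<in> I \<Longrightarrow> (\<gamma> has_vector_derivative V t) (at t)"
      "\<And>t. t \<in> I \<Longrightarrow> (V has_vector_derivative - connection (\<gamma> t) (V t) (V t)) (at t)"
    by (auto simp: geodesic_on_def christoffel_eq_connection)
  \<comment> \<open>If \<open>I\<close> is empty, any complete geodesic will do, so \<open>t0\<close> may be arbitrary.\<close>
  define t0 where "t0 = (SOME t. t \<in> I)"
  obtain \<sigma> W where \<sigma>: "\<sigma> t0 = \<gamma> t0" "W t0 = V t0"
    "\<And>t. (\<sigma> has_vector_derivative W t) (at t)"
    "\<And>t. (W has_vector_derivative - connection (\<sigma> t) (W t) (W t)) (at t)"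
    by (rule geodesic_exists[where ?t0.0 = t0 and P = "\<gamma> t0" and v = "V t0"]) blast
  have "\<sigma> t = \<gamma> t" if t: "t \<in> I" for t
  proof (rule second_order_unique(1)[OF I _ \<sigma>(3) _ \<gamma>(1) _ \<sigma>(1,2) t])
    show t0: "t0 \<in> I" using t unfolding t0_def by (metis someI)
    show "(V has_vector_derivative - connection (\<gamma> t0 + (t - t0) *\<^sub>R V t0) (V t0) (V t0)) (at t)"
      if "t \<in> I" for t
      by (rule geodesic_acceleration[OF I t0 \<gamma> that])
    show "(W has_vector_derivative - connection (\<gamma> t0 + (t - t0) *\<^sub>R V t0) (V t0) (V t0)) (at t)"
      if "t \<in> I" for t
      using geodesic_acceleration[OF I t0 \<sigma>(3,4) that] \<sigma>(1,2) by simp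
  qed
  with geodesic_on_UNIV[OF \<sigma>(3,4)]
  show "\<exists>\<sigma>. geodesic_on g UNIV \<sigma> \<and> (\<forall>t\<in>I. \<sigma> t = \<gamma> t)" by blast
qed

text \<open>
  The deviation of the exponential map at \<open>P\<close> from the affine map \<open>v \<mapsto> P + v\<close>.
\<close>

definition deflection :: "real ^ 'i coord \<Rightarrow> real ^ 'i coord \<Rightarrow> real ^ 'i coord" where
  "deflection P v = integral {0..1} (\<lambda>s. (1 - s) *\<^sub>R connection (P + s *\<^sub>R v) v v)"

lemma deflection_integrable: "(\<lambda>s. (1 - s) *\<^sub>R connection (P + s *\<^sub>R v) v v) integrable_on {0..1}"
proof -
  have "continuous_on {0..1} (\<lambda>s. connection (P + s *\<^sub>R v) v v)"
    using continuous_on_subset[OF connection_along_line_continuous[of P 0 v]] by simp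
  then show ?thesis
    by (intro integrable_continuous_interval continuous_intros)
qed

lemma deflection_nth: "deflection P v $ c = integral {0..1} (\<lambda>s. (1 - s) * connection (P + s *\<^sub>R v) v v $ c)"
  unfolding deflection_def
  by (subst integral_component_eq_cart[OF deflection_integrable, symmetric]) simp

text \<open>
  By \<open>geodesic_acceleration\<close> the acceleration on \<open>{0..1}\<close> is an explicit function of time, and
  Taylor's formula gives the end point of any geodesic with these initial data.
\<close>

lemma exp_relation_eq: "exp_relation g P v q \<longleftrightarrow> q = P + v - deflection P v"
proof
  assume "exp_relation g P v q"
  then obtain I \<gamma> V where I: "is_interval I" "{0..1} \<subseteq> I"
    and \<gamma>: "\<And>t. t \<in> I \<Longrightarrow> (\<gamma> has_vector_derivative V t) (at t)"
      "\<And>t. t \<in> I \<Longrightarrow> (V has_vector_derivative - connection (\<gamma> t) (V t) (V t)) (at t)"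
    and init: "\<gamma> 0 = P" "(\<gamma> has_vector_derivative v) (at 0)" and q: "\<gamma> 1 = q"
    by (auto simp: exp_relation_def geodesic_on_def christoffel_eq_connection)
  have 0: "0 \<in> I" using I(2) by auto
  have V0: "V 0 = v" using vector_derivative_unique_at[OF \<gamma>(1)[OF 0] init(2)] .
  have "\<gamma> 1 = \<gamma> 0 + V 0 + integral {0..1} (\<lambda>s. (1 - s) *\<^sub>R - connection (P + s *\<^sub>R v) v v)"
    using geodesic_acceleration[OF I(1) 0 \<gamma>] \<gamma>(1) I(2) init(1) V0
    by (intro second_order_Taylor) auto
  then show "q = P + v - deflection P v"
    using init q V0 by (simp add: deflection_def)
next
  assume q: "q = P + v - deflection P v"
  obtain \<sigma> V where \<sigma>: "\<sigma> 0 = P" "V 0 = v"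
    "\<And>t. (\<sigma> has_vector_derivative V t) (at t)"
    "\<And>t. (V has_vector_derivative - connection (\<sigma> t) (V t) (V t)) (at t)"
    by (rule geodesic_exists[where ?t0.0 = 0 and P = P and v = v]) blast
  have "\<sigma> 1 = \<sigma> 0 + V 0 + integral {0..1} (\<lambda>s. (1 - s) *\<^sub>R - connection (P + s *\<^sub>R v) v v)"
    using geodesic_acceleration[of UNIV 0 \<sigma> V] \<sigma>
    by (intro second_order_Taylor) (auto simp: is_interval_univ)
  then have "\<sigma> 1 = q" by (simp add: q \<sigma> deflection_def)
  then show "exp_relation g P v q"
    using geodesic_on_UNIV[OF \<sigma>(3,4)] \<sigma>(1,2) \<sigma>(3)[of 0] unfolding exp_relation_def by fastforce
qed

lemma base_eq_deflection: "base_eq (deflection P v) 0"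
  by (simp add: base_eq_def deflection_nth)

lemma deflection_base_cong:
  assumes "base_eq v w"
  shows "deflection P v = deflection P w"
proof -
  have "connection (P + s *\<^sub>R v) v v = connection (P + s *\<^sub>R w) w w" for s
    using assms by (intro connection_base_cong) (auto simp: base_eq_def)
  then show ?thesis by (simp add: deflection_def)
qed

lemma smooth_map_potential: "smooth_map (potential p f idx)"
proof -
  \<comment> \<open>Up to a factor, the potential is a component of the metric, whose smoothness is known.\<close>
  have "potential p f idx = (\<lambda>Q. (- 1 / 2) * g Q (axis X 1) (axis X 1))"
    by (simp add: fun_eq_iff neutral_metric_def flat_form_def axis_def)
  moreover have "smooth_map (\<lambda>Q. g Q (axis X 1) (axis X 1))"
    using pseudo_riemannian_metric[OF smooth_f, of p idx] by (simp add: pseudo_riemannian_def)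
  ultimately show ?thesis
    by (simp only:) (intro smooth_map_mult smooth_map_const)
qed

lemma smooth_map_jet1: "smooth_map (\<lambda>Q. jet 1 Q [a])"
  using smooth_map_frechet_derivative[OF smooth_map_potential, of a]
  by (simp add: frechet_derivative_at[OF potential_has_derivative, symmetric])

text \<open>
  Each component is a polynomial in \<open>v\<close> whose coefficients are averages of partial derivatives of the
  potential along the segment from \<open>P\<close> to \<open>P + v\<close>, and such averages are smooth in \<open>v\<close>.
\<close>

lemma smooth_map_deflection: "smooth_map (deflection P)"
proof (rule smooth_map_vec)
  fix c :: "'i coord"
  define A where "A a v = integral {0..1} (\<lambda>s. (1 - s) * jet 1 (P + s *\<^sub>R v) [a])" for a v
  have A: "smooth_map (A a)" for a
    unfolding A_def by (intro smooth_map_segment_integral smooth_map_jet1 continuous_intros)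
  have int: "(\<lambda>s. (1 - s) * jet 1 (P + s *\<^sub>R v) [a]) integrable_on {0..1}" for a v
  proof -
    have "continuous_on {0..1} (\<lambda>s. jet 1 (P + s *\<^sub>R v) [a])"
      by (rule continuous_on_compose2[OF smooth_map_continuous_on[OF smooth_map_jet1, of UNIV]])
        (auto intro!: continuous_intros)
    then show ?thesis
      by (intro integrable_continuous_interval continuous_intros)
  qed
  have Av: "A v v = A (axis Y 1) v * v $ Y + (\<Sum>j\<in>UNIV. A (axis (Z j) 1) v * v $ Z j)" for v
  proof -
    have "jet 1 Q [v] = jet 1 Q [axis Y 1] * v $ Y + (\<Sum>j\<in>UNIV. jet 1 Q [axis (Z j) 1] * v $ Z j)" for Q
      using z_jet_expand[of 0 Q v] by (simp add: jet_def z_jet_other axis_def)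
    then have "A v v = integral {0..1} (\<lambda>s. (1 - s) * jet 1 (P + s *\<^sub>R v) [axis Y 1] * v $ Y
        + (\<Sum>j\<in>UNIV. (1 - s) * jet 1 (P + s *\<^sub>R v) [axis (Z j) 1] * v $ Z j))"
      unfolding A_def by (simp add: algebra_simps sum_distrib_left sum_subtractf)
    also have "\<dots> = A (axis Y 1) v * v $ Y + (\<Sum>j\<in>UNIV. A (axis (Z j) 1) v * v $ Z j)"
      unfolding A_def
      by (simp add: integral_add integral_sum integrable_sum int integrable_on_mult_left del: One_nat_def)
    finally show ?thesis .
  qed
  show "smooth_map (\<lambda>v. deflection P v $ c)"
  proof (cases c)
    case Xb
    have "deflection P v $ c = - 2 * v $ X * A v v" for v
    proof -
      have "(\<lambda>s. (1 - s) * connection (P + s *\<^sub>R v) v v $ c) =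
          (\<lambda>s. - 2 * v $ X * ((1 - s) * jet 1 (P + s *\<^sub>R v) [v]))"
        by (simp add: Xb fun_eq_iff algebra_simps)
      then show ?thesis
        unfolding deflection_nth A_def by (simp only: integral_mult_right)
    qed
    then show ?thesis
      by (simp only: Av) (intro smooth_map_mult smooth_map_add smooth_map_const smooth_map_sum smooth_map_nth A finite)
  next
    case Yb
    have "deflection P v $ c = A (axis Y 1) v * (v $ X * v $ X)" for v
      by (simp add: Yb deflection_nth A_def mult.assoc[symmetric] del: One_nat_def)
    then show ?thesis
      by (simp only:) (intro smooth_map_mult smooth_map_nth A)
  next
    case (Zb j)
    have "deflection P v $ c = A (axis (Z j) 1) v * (v $ X * v $ X)" for v
      by (simp add: Zb deflection_nth A_def mult.assoc[symmetric] del: One_nat_def)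
    then show ?thesis
      by (simp only:) (intro smooth_map_mult smooth_map_nth A)
  qed (simp_all add: deflection_nth smooth_map_const)
qed

text \<open>
  The deflection is vertical and depends only on base components, so adding it to \<open>q - P\<close> undoes the
  exponential map.
\<close>

lemma metric_exp_diffeomorphism: "exp_is_diffeomorphism g P"
proof -
  define E where "E v = P + v - deflection P v" for v
  define E' where "E' q = (q - P) + deflection P (q - P)" for q
  have exp: "exp_map g P = E"
    by (simp add: fun_eq_iff exp_map_def exp_relation_eq E_def)
  have E'E: "E' (E v) = v" for v
    using deflection_base_cong[of "E v - P" v P] base_eq_deflection[of P v]
    by (simp add: E_def E'_def base_eq_def)
  have EE': "E (E' q) = q" for q
    using deflection_base_cong[of "E' q" "q - P" P] base_eq_deflection[of P "q - P"]
    by (simp add: E_def E'_def base_eq_def)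
  have "bij E" using E'E EE' by (metis bijI')
  moreover have "inv E = E'" using E'E EE' by (rule inv_equality)
  moreover have "smooth_map E"
    unfolding E_def
    by (intro smooth_map_diff smooth_map_add smooth_map_const smooth_map_deflection
        smooth_map_linear bounded_linear_ident)
  moreover have "smooth_map E'"
    unfolding E'_def
    by (intro smooth_map_shift[where f = "\<lambda>w. w + deflection P w"] smooth_map_add
        smooth_map_deflection smooth_map_linear bounded_linear_ident)
  ultimately have "diffeomorphism E" by (simp add: diffeomorphism_def)
  then show ?thesis
    by (simp add: exp_is_diffeomorphism_def exp exp_relation_eq)
qed

end

section \<open>The model tensors as Kulkarni-Nomizu products\<close>

lemma sum_words_Suc:
  fixes h :: "'c::finite list \<Rightarrow> real"
  shows "(\<Sum>cs | length cs = Suc n. h cs) = (\<Sum>c\<in>UNIV. \<Sum>cs | length cs = n. h (c # cs))"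
proof -
  have "{cs :: 'c list. length cs = Suc n} = (\<lambda>(c, cs). c # cs) ` (UNIV \<times> {cs. length cs = n})"
    by (auto simp: length_Suc_conv)
  moreover have "inj_on (\<lambda>(c, cs). c # cs) (UNIV \<times> {cs :: 'c list. length cs = n})"
    by (auto simp: inj_on_def)
  ultimately show ?thesis
    by (simp add: sum.reindex sum.cartesian_product case_prod_unfold)
qed

lemma sum_single:
  fixes h :: "'c::finite \<Rightarrow> real"
  assumes "\<And>x. x \<noteq> a \<Longrightarrow> h x = 0"
  shows "(\<Sum>x\<in>UNIV. h x) = h a"
proof -
  have "(\<Sum>x\<in>UNIV. h x) = (\<Sum>x\<in>{a}. h x)"
    by (rule sum.mono_neutral_right) (use assms in auto)
  then show ?thesis by simp
qed

definition y_word :: "'i coord list \<Rightarrow> bool" where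
  "y_word cs \<longleftrightarrow> cs = replicate (length cs) Y"

primrec one_z_word :: "'i coord \<Rightarrow> 'i coord list \<Rightarrow> bool" where
  "one_z_word z [] \<longleftrightarrow> False"
| "one_z_word z (c # cs) \<longleftrightarrow> c = z \<and> y_word cs \<or> c = Y \<and> one_z_word z cs"

lemma y_word_simps [simp]: "y_word []" "y_word (c # cs) \<longleftrightarrow> c = Y \<and> y_word cs"
  by (auto simp: y_word_def)

lemma one_z_word_iff: "one_z_word z cs \<longleftrightarrow> (\<exists>j<length cs. cs = (replicate (length cs) Y)[j := z])"
proof (induction cs)
  case (Cons c cs)
  have "(\<exists>j<length (c # cs). c # cs = (replicate (length (c # cs)) Y)[j := z]) \<longleftrightarrow>
      c # cs = z # replicate (length cs) Y \<or>
      (\<exists>j<length cs. c # cs = Y # (replicate (length cs) Y)[j := z])"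
    by (simp add: Ex_less_Suc2)
  also have "\<dots> \<longleftrightarrow> one_z_word z (c # cs)"
    using Cons by (auto simp: y_word_def)
  finally show ?case ..
qed simp

lemma sum_y_word:
  "length as = n \<Longrightarrow>
    (\<Sum>cs | length cs = n. of_bool (y_word cs) * (\<Prod>j<n. as ! j $ cs ! j)) = y_product as"
proof (induction as arbitrary: n)
  case (Cons a as)
  then obtain m where n: "n = Suc m" and m: "length as = m" by auto
  have "(\<Sum>cs | length cs = n. of_bool (y_word cs) * (\<Prod>j<n. (a # as) ! j $ cs ! j)) =
      (\<Sum>c\<in>UNIV. \<Sum>cs | length cs = m. of_bool (y_word (c # cs)) * (a $ c * (\<Prod>j<m. as ! j $ cs ! j)))"
    unfolding n sum_words_Suc by (simp add: prod.lessThan_Suc_shift del: prod.lessThan_Suc)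
  also have "\<dots> = (\<Sum>cs | length cs = m. of_bool (y_word cs) * (a $ Y * (\<Prod>j<m. as ! j $ cs ! j)))"
    by (subst sum_single[where a = Y]) simp_all
  also have "\<dots> = a $ Y * y_product as"
    unfolding Cons.IH[OF m, symmetric] sum_distrib_left by (simp add: mult.left_commute)
  finally show ?case by simp
qed simp

lemma sum_one_z_word:
  assumes "z \<noteq> Y"
  shows "length as = n \<Longrightarrow>
    (\<Sum>cs | length cs = n. of_bool (one_z_word z cs) * (\<Prod>j<n. as ! j $ cs ! j)) =
    one_slot_sum (\<lambda>a. a $ z) as"
proof (induction as arbitrary: n)
  case (Cons a as)
  then obtain m where n: "n = Suc m" and m: "length as = m" by auto
  have "(\<Sum>cs | length cs = n. of_bool (one_z_word z cs) * (\<Prod>j<n. (a # as) ! j $ cs ! j)) =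
      (\<Sum>c\<in>UNIV. (\<Sum>cs | length cs = m. of_bool (c = z \<and> y_word cs) * (a $ c * (\<Prod>j<m. as ! j $ cs ! j)))
        + (\<Sum>cs | length cs = m. of_bool (c = Y \<and> one_z_word z cs) * (a $ c * (\<Prod>j<m. as ! j $ cs ! j))))"
    unfolding n sum_words_Suc sum.distrib[symmetric]
    using assms by (intro sum.cong) (auto simp: prod.lessThan_Suc_shift simp del: prod.lessThan_Suc)
  also have "\<dots> = (\<Sum>cs | length cs = m. of_bool (y_word cs) * (a $ z * (\<Prod>j<m. as ! j $ cs ! j)))
      + (\<Sum>cs | length cs = m. of_bool (one_z_word z cs) * (a $ Y * (\<Prod>j<m. as ! j $ cs ! j)))"
    unfolding sum.distrib by (intro arg_cong2[of _ _ _ _ "(+)"]; subst sum_single[where a = z] sum_single[where a = Y]; simp)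
  also have "\<dots> = a $ z * y_product as + a $ Y * one_slot_sum (\<lambda>a. a $ z) as"
    unfolding Cons.IH[OF m, symmetric] sum_y_word[OF m, symmetric] sum_distrib_left
    by (simp add: mult.left_commute)
  finally show ?case by simp
qed simp

text \<open>
  The words at which the symmetric form underlying the \<open>k\<close>-th model tensor has coefficient 1; at all
  other words the coefficient is 0.
\<close>

definition slot_word :: "nat \<Rightarrow> (nat \<Rightarrow> 'i) \<Rightarrow> nat \<Rightarrow> 'i coord list \<Rightarrow> bool" where
  "slot_word p idx k = (if k \<le> p then one_z_word (Z (idx k)) else y_word)"

definition slot_form :: "nat \<Rightarrow> (nat \<Rightarrow> 'i::finite) \<Rightarrow> nat \<Rightarrow> (real ^ 'i coord) list \<Rightarrow> real" where
  "slot_form p idx k = (if k \<le> p then one_slot_sum (\<lambda>a. a $ Z (idx k)) else y_product)"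

lemma sum_slot_word:
  "length as = n \<Longrightarrow>
    (\<Sum>cs | length cs = n. of_bool (slot_word p idx k cs) * (\<Prod>j<n. as ! j $ cs ! j)) =
    slot_form p idx k as"
  by (simp add: slot_word_def slot_form_def sum_y_word sum_one_z_word)

lemma unit_entries_iff:
  assumes "length es = k" "k \<le> p + 2"
  shows "a # b # c # d # es \<in> unit_entries p idx k \<longleftrightarrow>
    a = X \<and> b = Y \<and> d = X \<and>
    (if k \<le> p then c = Z (idx k) \<and> y_word es \<or> c = Y \<and> one_z_word (Z (idx k)) es
     else c = Y \<and> y_word es)"
  using assms by (auto simp: unit_entries_def y_word_def one_z_word_iff)

text \<open>
  The symmetries form a group of order eight, but only four terms occur: the words of \<open>slot_word\<close> are
  invariant under permutations of their letters, so reversing the first four slots fixes the first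
  term, and the other three are its remaining images under the group.
\<close>

lemma model_component_eq:
  assumes "length es = k" "k \<le> p + 2"
  shows "model_component p idx k (a # b # c # d # es) =
      of_bool (slot_word p idx k (b # c # es)) * of_bool (a = X \<and> d = X)
    - of_bool (slot_word p idx k (a # c # es)) * of_bool (b = X \<and> d = X)
    + of_bool (slot_word p idx k (a # d # es)) * of_bool (b = X \<and> c = X)
    - of_bool (slot_word p idx k (b # d # es)) * of_bool (a = X \<and> c = X)"
  unfolding model_component_def list.case Int_insert_left Int_empty_left unit_entries_iff[OF assms]
  by (cases "k \<le> p"; cases "a = X"; cases "b = X"; cases "c = X"; cases "d = X")
    (auto simp: slot_word_def unit_entries_iff[OF assms])

text \<open>
  After expansion over the first four letters, each of the four terms of \<open>model_component_eq\<close> fixes two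
  of these letters to be \<open>X\<close>; the remaining sums are the expansion of \<open>slot_form\<close>.
\<close>

lemma model_tensor_eq:
  assumes "length vs = 4 + k" "k \<le> p + 2"
  shows "model_tensor p idx k vs = kulkarni_nomizu (slot_form p idx k) vs"
proof -
  obtain u v w t es where vs: "vs = u # v # w # t # es" and es: "length es = k"
    using length_4_plus[OF assms(1)] .
  let ?w = "slot_word p idx k"
  let ?m = "\<lambda>cs. \<Prod>j<k. es ! j $ cs ! j"
  define K where "K b c = (\<Sum>cs | length cs = k. of_bool (?w (b # c # cs)) * ?m cs)" for b c
  have S: "slot_form p idx k (x # y # es) = (\<Sum>b\<in>UNIV. \<Sum>c\<in>UNIV. x $ b * y $ c * K b c)" for x y
  proof -
    have "slot_form p idx k (x # y # es) =
      (\<Sum>b\<in>UNIV. \<Sum>c\<in>UNIV. \<Sum>cs | length cs = k. of_bool (?w (b # c # cs)) * (x $ b * (y $ c * ?m cs)))"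
      using sum_slot_word[of "x # y # es" "Suc (Suc k)" p idx k] es
      by (simp add: sum_words_Suc prod.lessThan_Suc_shift
          del: prod.lessThan_Suc sum_of_bool_mult_eq sum_mult_of_bool_eq)
    then show ?thesis
      unfolding K_def by (simp add: sum_distrib_left mult_ac)
  qed
  define F where "F a b c d = u $ a * v $ b * w $ c * t $ d" for a b c d
  have "model_tensor p idx k vs =
    (\<Sum>a\<in>UNIV. \<Sum>b\<in>UNIV. \<Sum>c\<in>UNIV. \<Sum>d\<in>UNIV. \<Sum>cs | length cs = k.
      model_component p idx k (a # b # c # d # cs) * (F a b c d * ?m cs))"
    unfolding model_tensor_def vs
    by (simp add: numeral_eq_Suc sum_words_Suc prod.lessThan_Suc_shift F_def mult.assoc
        del: prod.lessThan_Suc)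
  also have "\<dots> = (\<Sum>a\<in>UNIV. \<Sum>b\<in>UNIV. \<Sum>c\<in>UNIV. \<Sum>d\<in>UNIV.
        F a b c d * (of_bool (a = X \<and> d = X) * K b c) - F a b c d * (of_bool (b = X \<and> d = X) * K a c)
      + F a b c d * (of_bool (b = X \<and> c = X) * K a d) - F a b c d * (of_bool (a = X \<and> c = X) * K b d))"
  proof (intro sum.cong refl)
    fix a b c d
    have "(\<Sum>cs | length cs = k. model_component p idx k (a # b # c # d # cs) * (F a b c d * ?m cs)) =
      (\<Sum>cs | length cs = k.
          F a b c d * (of_bool (a = X \<and> d = X) * (of_bool (?w (b # c # cs)) * ?m cs))
        - F a b c d * (of_bool (b = X \<and> d = X) * (of_bool (?w (a # c # cs)) * ?m cs))
        + F a b c d * (of_bool (b = X \<and> c = X) * (of_bool (?w (a # d # cs)) * ?m cs))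
        - F a b c d * (of_bool (a = X \<and> c = X) * (of_bool (?w (b # d # cs)) * ?m cs)))"
    proof (intro sum.cong refl)
      fix cs :: "'a coord list" assume "cs \<in> {cs. length cs = k}"
      then have len: "length cs = k" by simp
      show "model_component p idx k (a # b # c # d # cs) * (F a b c d * ?m cs) =
          F a b c d * (of_bool (a = X \<and> d = X) * (of_bool (?w (b # c # cs)) * ?m cs))
        - F a b c d * (of_bool (b = X \<and> d = X) * (of_bool (?w (a # c # cs)) * ?m cs))
        + F a b c d * (of_bool (b = X \<and> c = X) * (of_bool (?w (a # d # cs)) * ?m cs))
        - F a b c d * (of_bool (a = X \<and> c = X) * (of_bool (?w (b # d # cs)) * ?m cs))"
        unfolding model_component_eq[OF len assms(2)] by algebra
    qed
    then show "(\<Sum>cs | length cs = k. model_component p idx k (a # b # c # d # cs) * (F a b c d * ?m cs)) =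
        F a b c d * (of_bool (a = X \<and> d = X) * K b c) - F a b c d * (of_bool (b = X \<and> d = X) * K a c)
      + F a b c d * (of_bool (b = X \<and> c = X) * K a d) - F a b c d * (of_bool (a = X \<and> c = X) * K b d)"
      by (simp only: sum.distrib sum_subtractf K_def sum_distrib_left)
  qed
  also have "\<dots> =
      (\<Sum>b\<in>UNIV. \<Sum>c\<in>UNIV. F X b c X * K b c) - (\<Sum>a\<in>UNIV. \<Sum>c\<in>UNIV. F a X c X * K a c)
    + (\<Sum>a\<in>UNIV. \<Sum>d\<in>UNIV. F a X X d * K a d) - (\<Sum>b\<in>UNIV. \<Sum>d\<in>UNIV. F X b X d * K b d)"
  proof -
    have 1: "(\<Sum>a\<in>UNIV. \<Sum>b\<in>UNIV. \<Sum>c\<in>UNIV. \<Sum>d\<in>UNIV. F a b c d * (of_bool (a = X \<and> d = X) * K b c)) =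
        (\<Sum>b\<in>UNIV. \<Sum>c\<in>UNIV. F X b c X * K b c)"
      by (subst sum_single[where a = X], simp, intro sum.cong refl, subst sum_single[where a = X]) simp_all
    have 2: "(\<Sum>a\<in>UNIV. \<Sum>b\<in>UNIV. \<Sum>c\<in>UNIV. \<Sum>d\<in>UNIV. F a b c d * (of_bool (b = X \<and> d = X) * K a c)) =
        (\<Sum>a\<in>UNIV. \<Sum>c\<in>UNIV. F a X c X * K a c)"
      by (rule sum.cong, rule refl, subst sum_single[where a = X], simp, intro sum.cong refl,
          subst sum_single[where a = X]) simp_all
    have 3: "(\<Sum>a\<in>UNIV. \<Sum>b\<in>UNIV. \<Sum>c\<in>UNIV. \<Sum>d\<in>UNIV. F a b c d * (of_bool (b = X \<and> c = X) * K a d)) =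
        (\<Sum>a\<in>UNIV. \<Sum>d\<in>UNIV. F a X X d * K a d)"
      by (rule sum.cong, rule refl, subst sum_single[where a = X], simp, subst sum_single[where a = X])
        simp_all
    have 4: "(\<Sum>a\<in>UNIV. \<Sum>b\<in>UNIV. \<Sum>c\<in>UNIV. \<Sum>d\<in>UNIV. F a b c d * (of_bool (a = X \<and> c = X) * K b d)) =
        (\<Sum>b\<in>UNIV. \<Sum>d\<in>UNIV. F X b X d * K b d)"
      by (subst sum_single[where a = X], simp, rule sum.cong, rule refl, subst sum_single[where a = X])
        simp_all
    show ?thesis by (simp only: sum.distrib sum_subtractf 1 2 3 4)
  qed
  also have "\<dots> = kulkarni_nomizu (slot_form p idx k) vs"
    unfolding vs kulkarni_nomizu_Cons S F_def by (simp add: sum_distrib_left mult_ac)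
  finally show ?thesis .
qed

lemma multilinear_model_tensor: "multilinear (4 + k) (model_tensor p idx k)"
  unfolding multilinear_def
proof (intro allI impI)
  fix vs :: "(real ^ 'a coord) list" and i
  assume i: "length vs = 4 + k" "i < 4 + k"
  have "linear (\<lambda>v. \<Sum>cs | length cs = 4 + k.
      model_component p idx k cs * (\<Prod>j\<in>{..<4 + k} - {i}. vs ! j $ cs ! j) * v $ (cs ! i))"
    by (intro linear_compose_sum ballI impI linearI) (simp_all add: algebra_simps)
  moreover have "(\<Prod>j<4 + k. vs[i := v] ! j $ cs ! j) =
      (\<Prod>j\<in>{..<4 + k} - {i}. vs ! j $ cs ! j) * v $ (cs ! i)" for v and cs :: "'a coord list"
  proof -
    have "(\<Prod>j<4 + k. vs[i := v] ! j $ cs ! j) =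
        v $ (cs ! i) * (\<Prod>j\<in>{..<4 + k} - {i}. vs[i := v] ! j $ cs ! j)"
      using i by (subst prod.remove[of _ i]) simp_all
    also have "(\<Prod>j\<in>{..<4 + k} - {i}. vs[i := v] ! j $ cs ! j) = (\<Prod>j\<in>{..<4 + k} - {i}. vs ! j $ cs ! j)"
      by (intro prod.cong) auto
    finally show ?thesis by simp
  qed
  ultimately show "linear (\<lambda>v. model_tensor p idx k (vs[i := v]))"
    by (simp add: model_tensor_def mult.assoc)
qed

lemma k_model_model_tensor: "k_model k flat_form (model_tensor p (idx :: nat \<Rightarrow> 'i::finite))"
proof -
  have "flat_form = neutral_metric p (\<lambda>_. 0) idx 0"
    by (simp add: fun_eq_iff neutral_metric_def potential_def)
  then have "inner_product_form (flat_form :: real ^ 'i coord \<Rightarrow> _)"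
    by (metis inner_product_form_metric)
  moreover have "\<exists>B :: (real ^ 'i coord) set. finite B \<and> span B = UNIV"
    by (intro exI[of _ Basis]) simp
  ultimately show ?thesis
    by (simp add: k_model_def multilinear_model_tensor)
qed

section \<open>Normalising the curvature at a point\<close>

text \<open>
  The matrix of derivatives of \<open>y\<^bsup>j+1\<^esup>\<close> is triangular with diagonal entries \<open>(k + 1)!\<close>. The row of the
  largest index \<open>m\<close> with \<open>x m \<noteq> 0\<close> reduces to its diagonal term: smaller exponents are annihilated
  by the derivative, larger indices by the choice of \<open>m\<close>.
\<close>

lemma power_deriv_triangular:
  assumes "\<And>k. k \<le> p \<Longrightarrow> (\<Sum>j\<le>p. power_deriv (j + 1) (k + 1) y * x j) = 0"
    and "k \<le> p"
  shows "x k = 0"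
proof (rule ccontr)
  assume "x k \<noteq> 0"
  define m where "m = Max {k. k \<le> p \<and> x k \<noteq> 0}"
  have fin: "finite {k. k \<le> p \<and> x k \<noteq> 0}" by simp
  have "m \<in> {k. k \<le> p \<and> x k \<noteq> 0}"
    unfolding m_def by (rule Max_in) (use fin \<open>x k \<noteq> 0\<close> assms(2) in auto)
  then have m: "m \<le> p" "x m \<noteq> 0" by auto
  have above: "x j = 0" if "m < j" "j \<le> p" for j
  proof (rule ccontr)
    assume "x j \<noteq> 0"
    with that(2) have "j \<le> m" unfolding m_def by (intro Max_ge fin) simp
    with that(1) show False by simp
  qed
  have "(\<Sum>j\<le>p. power_deriv (j + 1) (m + 1) y * x j) = (\<Sum>j\<in>{m}. power_deriv (j + 1) (m + 1) y * x j)"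
  proof (rule sum.mono_neutral_right)
    show "\<forall>j\<in>{..p} - {m}. power_deriv (j + 1) (m + 1) y * x j = 0"
      using above by (auto simp: power_deriv_eq_0 nat_neq_iff)
  qed (use m in auto)
  also have "\<dots> = fact (m + 1) * x m" by (simp add: power_deriv_self del: fact_Suc)
  finally show False using assms(1)[OF m(1)] m(2) by simp
qed

text \<open>
  A linear map of the base coordinates extends to an isometry onto the flat form by acting on the
  barred coordinates through the inverse transpose. The coordinate \<open>u $ Xb\<close> is first corrected by
  \<open>F * u $ X\<close>, which absorbs the only non-constant coefficient of the metric.
\<close>

lemma isometry_extending_base_map:
  fixes M :: "real ^ 'i ^ ('i::finite)" and b :: "real ^ 'i"
  assumes "\<alpha> \<noteq> 0" "\<beta> \<noteq> 0" and M: "\<And>x. M *v x = 0 \<Longrightarrow> x = 0"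
  obtains \<phi> :: "real ^ 'i coord \<Rightarrow> real ^ 'i coord" where "linear \<phi>"
    "\<And>u. \<phi> u $ X = \<alpha> * u $ X" "\<And>u. \<phi> u $ Y = \<beta> * u $ Y"
    "\<And>u i. \<phi> u $ Z i = b $ i * u $ Y + (M *v (\<chi> j. u $ Z j)) $ i"
    "\<And>u v. flat_form (\<phi> u) (\<phi> v) = flat_form u v - 2 * F * u $ X * v $ X"
proof -
  obtain B where B: "B ** M = mat 1"
    using M matrix_left_invertible_ker[of M] by auto
  define N where "N = transpose B"
  define zp where "zp u = (\<chi> j. u $ Z j)" for u :: "real ^ 'i coord"
  define zbp where "zbp u = (\<chi> j. u $ Zb j)" for u :: "real ^ 'i coord"
  have lin: "zp (u + v) = zp u + zp v" "zp (r *\<^sub>R u) = r *\<^sub>R zp u"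
    "zbp (u + v) = zbp u + zbp v" "zbp (r *\<^sub>R u) = r *\<^sub>R zbp u" for u v r
    by (simp_all add: zp_def zbp_def vec_eq_iff)
  have dual: "(M *v x) \<bullet> (N *v y) = x \<bullet> y" for x y
  proof -
    have "(M *v x) \<bullet> (N *v y) = (y v* B) \<bullet> (M *v x)"
      by (simp add: N_def inner_commute)
    also have "\<dots> = y \<bullet> x"
      by (simp add: dot_lmul_matrix matrix_vector_mul_assoc B)
    finally show ?thesis by (simp add: inner_commute)
  qed
  define \<phi> where "\<phi> u = (\<chi> c. case c of
      X \<Rightarrow> \<alpha> * u $ X | Y \<Rightarrow> \<beta> * u $ Y | Z i \<Rightarrow> b $ i * u $ Y + (M *v zp u) $ i
    | Xb \<Rightarrow> (u $ Xb - F * u $ X) / \<alpha> | Yb \<Rightarrow> (u $ Yb - b \<bullet> (N *v zbp u)) / \<beta>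
    | Zb i \<Rightarrow> (N *v zbp u) $ i)" for u
  have nth: "\<phi> u $ X = \<alpha> * u $ X" "\<phi> u $ Y = \<beta> * u $ Y"
    "\<phi> u $ Z i = b $ i * u $ Y + (M *v zp u) $ i"
    "\<phi> u $ Xb = (u $ Xb - F * u $ X) / \<alpha>" "\<phi> u $ Yb = (u $ Yb - b \<bullet> (N *v zbp u)) / \<beta>"
    "\<phi> u $ Zb i = (N *v zbp u) $ i" for u i
    by (simp_all add: \<phi>_def)
  have "linear \<phi>"
  proof (rule linearI)
    show "\<phi> (u + v) = \<phi> u + \<phi> v" for u v
    proof -
      have "\<phi> (u + v) $ c = (\<phi> u + \<phi> v) $ c" for c
        by (cases c) (simp_all add: nth lin matrix_vector_right_distrib inner_add_right
            add_divide_distrib diff_divide_distrib algebra_simps)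
      then show ?thesis by (simp add: vec_eq_iff)
    qed
    show "\<phi> (r *\<^sub>R u) = r *\<^sub>R \<phi> u" for r u
    proof -
      have "\<phi> (r *\<^sub>R u) $ c = (r *\<^sub>R \<phi> u) $ c" for c
        by (cases c) (simp_all add: nth lin matrix_vector_mult_scaleR inner_scaleR_right
            diff_divide_distrib algebra_simps)
      then show ?thesis by (simp add: vec_eq_iff)
    qed
  qed
  moreover have "flat_form (\<phi> u) (\<phi> v) = flat_form u v - 2 * F * u $ X * v $ X" for u v
  proof -
    have z: "(\<Sum>j\<in>UNIV. \<phi> u $ Z j * \<phi> v $ Zb j) = u $ Y * (b \<bullet> (N *v zbp v)) + zp u \<bullet> zbp v" for u v
    proof -
      have "(\<Sum>j\<in>UNIV. \<phi> u $ Z j * \<phi> v $ Zb j) =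
          u $ Y * (b \<bullet> (N *v zbp v)) + (M *v zp u) \<bullet> (N *v zbp v)"
        by (simp add: nth inner_vec_def algebra_simps sum.distrib sum_distrib_left)
      then show ?thesis by (simp only: dual)
    qed
    have z': "(\<Sum>j\<in>UNIV. \<phi> u $ Zb j * \<phi> v $ Z j) = v $ Y * (b \<bullet> (N *v zbp u)) + zp v \<bullet> zbp u"
      using z[of v u] by (simp add: mult.commute)
    have "flat_form u v = u $ X * v $ Xb + u $ Xb * v $ X + u $ Y * v $ Yb + u $ Yb * v $ Y
        + zp u \<bullet> zbp v + zp v \<bullet> zbp u"
      by (simp add: flat_form_def inner_vec_def zp_def zbp_def sum.distrib mult.commute)
    moreover have "flat_form (\<phi> u) (\<phi> v) = u $ X * (v $ Xb - F * v $ X) + (u $ Xb - F * u $ X) * v $ X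
        + u $ Y * (v $ Yb - b \<bullet> (N *v zbp v)) + (u $ Yb - b \<bullet> (N *v zbp u)) * v $ Y
        + (u $ Y * (b \<bullet> (N *v zbp v)) + zp u \<bullet> zbp v + (v $ Y * (b \<bullet> (N *v zbp u)) + zp v \<bullet> zbp u))"
    proof -
      have "\<phi> u $ X * \<phi> v $ Xb = u $ X * (v $ Xb - F * v $ X)"
        "\<phi> u $ Y * \<phi> v $ Yb = u $ Y * (v $ Yb - b \<bullet> (N *v zbp v))"
        "\<phi> u $ Xb * \<phi> v $ X = (u $ Xb - F * u $ X) * v $ X"
        "\<phi> u $ Yb * \<phi> v $ Y = (u $ Yb - b \<bullet> (N *v zbp u)) * v $ Y"
        using assms(1,2) by (simp_all only: nth) simp_all
      then show ?thesis
        by (simp only: flat_form_def sum.distrib z z')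
    qed
    ultimately show ?thesis by (simp add: algebra_simps)
  qed
  ultimately show ?thesis
    using that[of \<phi>] nth(1,2,3) by (simp add: zp_def)
qed

text \<open>
  Each term contains two factors \<open>x\<close>, whence the square of the scale.
\<close>

lemma kulkarni_nomizu_pullback:
  assumes \<phi>: "\<And>u. \<phi> u $ X = \<alpha> * u $ X"
    and S: "\<And>as. length as = 2 + k \<Longrightarrow> \<alpha>\<^sup>2 * S (map \<phi> as) = T as"
    and vs: "length vs = 4 + k"
  shows "kulkarni_nomizu S (map \<phi> vs) = kulkarni_nomizu T vs"
proof -
  obtain u v w t es where vs: "vs = u # v # w # t # es" and es: "length es = k"
    using length_4_plus[OF vs] .
  have T: "T (x # y # es) = \<alpha>\<^sup>2 * S (\<phi> x # \<phi> y # map \<phi> es)" for x y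
    using S[of "x # y # es"] es by simp
  show ?thesis
    unfolding vs by (simp add: T \<phi> power2_eq_square algebra_simps)
qed

lemma y_product_map:
  assumes "\<And>u. \<phi> u $ Y = \<beta> * u $ Y"
  shows "y_product (map \<phi> as) = \<beta> ^ length as * y_product as"
  by (induction as) (simp_all add: assms)

text \<open>
  The factor \<open>\<beta>\<close> on the left makes the identity hold for the empty list too, where the exponent
  \<open>length as - 1\<close> would be truncated.
\<close>

lemma one_slot_sum_map:
  assumes "\<And>u. \<phi> u $ Y = \<beta> * u $ Y"
  shows "\<beta> * one_slot_sum l (map \<phi> as) = \<beta> ^ length as * one_slot_sum (\<lambda>a. l (\<phi> a)) as"
proof (induction as)
  case (Cons a as)
  have "\<beta> * one_slot_sum l (map \<phi> (a # as)) =
      l (\<phi> a) * (\<beta> * y_product (map \<phi> as)) + \<beta> * a $ Y * (\<beta> * one_slot_sum l (map \<phi> as))"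
    by (simp add: assms algebra_simps)
  then show ?case
    unfolding Cons.IH y_product_map[OF assms] by (simp add: algebra_simps)
qed simp

context potential_family
begin

text \<open>
  The prescribed \<open>Z (idx k)\<close>-coordinate is chosen so that its symmetric product with
  \<open>(\<beta> dy)\<^bsup>k+1\<^esup>\<close>, multiplied by \<open>\<alpha>\<^sup>2\<close>, is \<open>jet (k + 2) P\<close>. The factor \<open>k + 2\<close> is divided out because
  the symmetric product of \<open>dy\<close> with \<open>dy\<^bsup>k+1\<^esup>\<close> counts every slot once.
\<close>

lemma normalising_isometry:
  assumes idx: "bij_betw idx {..p} UNIV" and "\<alpha> \<noteq> 0" "\<beta> \<noteq> 0"
  obtains \<phi> where "linear \<phi>" "bij \<phi>" "\<And>u v. flat_form (\<phi> u) (\<phi> v) = g P u v"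
    "\<And>u. \<phi> u $ X = \<alpha> * u $ X" "\<And>u. \<phi> u $ Y = \<beta> * u $ Y"
    "\<And>u k. k \<le> p \<Longrightarrow> \<phi> u $ Z (idx k) =
      (y_jet (k + 2) P / (k + 2) * u $ Y + z_jet (k + 1) P u) / (\<alpha>\<^sup>2 * \<beta> ^ (k + 1))"
proof -
  \<comment> \<open>The rows and columns of a matrix are indexed by the type, so exponents are read off via \<open>idx\<close>.\<close>
  define \<kappa> where "\<kappa> = inv_into {..p} idx"
  have \<kappa>: "\<kappa> (idx k) = k" if "k \<le> p" for k
    using that idx by (simp add: \<kappa>_def bij_betw_def)
  define s where "s k = \<alpha>\<^sup>2 * \<beta> ^ (k + 1)" for k :: nat
  have s: "s k \<noteq> 0" for k using assms by (simp add: s_def)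
  define M :: "real ^ 'i ^ 'i" where
    "M = (\<chi> i j. power_deriv (\<kappa> j + 1) (\<kappa> i + 1) (P $ Y) / s (\<kappa> i))"
  define b :: "real ^ 'i" where "b = (\<chi> i. y_jet (\<kappa> i + 2) P / (\<kappa> i + 2) / s (\<kappa> i))"
  have M: "(M *v x) $ idx k = (\<Sum>j\<le>p. power_deriv (j + 1) (k + 1) (P $ Y) * x $ idx j) / s k"
    if "k \<le> p" for x k
  proof -
    have "(M *v x) $ idx k =
        (\<Sum>j\<in>UNIV. power_deriv (\<kappa> j + 1) (k + 1) (P $ Y) / s k * x $ j)"
      by (simp add: matrix_vector_mult_def M_def \<kappa>[OF that])
    also have "\<dots> = (\<Sum>j\<le>p. power_deriv (\<kappa> (idx j) + 1) (k + 1) (P $ Y) / s k * x $ idx j)"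
      by (rule sum.reindex_bij_betw[OF idx, symmetric])
    finally show ?thesis
      by (simp add: \<kappa> sum_divide_distrib)
  qed
  have M0: "x = 0" if "M *v x = 0" for x
  proof -
    have "(\<Sum>j\<le>p. power_deriv (j + 1) (k + 1) (P $ Y) * x $ idx j) = 0" if "k \<le> p" for k
      using M[OF that, of x] s[of k] \<open>M *v x = 0\<close> by simp
    then have "x $ idx k = 0" if "k \<le> p" for k
      using power_deriv_triangular[of p "P $ Y" "\<lambda>j. x $ idx j"] that by blast
    then have "x $ i = 0" for i
      using idx by (metis UNIV_I atMost_iff bij_betw_iff_bijections)
    then show ?thesis by (simp add: vec_eq_iff)
  qed
  obtain \<phi> where \<phi>: "linear \<phi>" "\<And>u. \<phi> u $ X = \<alpha> * u $ X" "\<And>u. \<phi> u $ Y = \<beta> * u $ Y"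
      "\<And>u i. \<phi> u $ Z i = b $ i * u $ Y + (M *v (\<chi> j. u $ Z j)) $ i"
      "\<And>u v. flat_form (\<phi> u) (\<phi> v) = flat_form u v - 2 * potential p f idx P * u $ X * v $ X"
    by (rule isometry_extending_base_map[where M = M and b = b and F = "potential p f idx P",
        OF assms(2,3) M0], assumption) (rule that)
  have iso: "flat_form (\<phi> u) (\<phi> v) = g P u v" for u v
    by (simp add: \<phi>(5) neutral_metric_def)
  have "inj \<phi>"
    unfolding linear_injective_0[OF \<phi>(1)]
  proof (intro allI impI)
    fix u assume "\<phi> u = 0"
    then have "g P u v = 0" for v
      unfolding iso[symmetric] by (simp add: flat_form_def)
    then show "u = 0"
      using inner_product_form_metric[of p f idx P] unfolding inner_product_form_def by blast
  qed
  then have "bij \<phi>"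
    using linear_injective_imp_surjective[OF \<phi>(1)] by (simp add: bij_def)
  moreover have "\<phi> u $ Z (idx k) =
      (y_jet (k + 2) P / (k + 2) * u $ Y + z_jet (k + 1) P u) / (\<alpha>\<^sup>2 * \<beta> ^ (k + 1))"
    if "k \<le> p" for u k
    unfolding \<phi>(4) M[OF that] s_def[symmetric]
    by (simp add: b_def \<kappa>[OF that] z_jet_def add_divide_distrib)
  ultimately show ?thesis
    using that[of \<phi>] \<phi>(1,2,3) iso by blast
qed

text \<open>
  The coefficients \<open>y\<^bsup>j+1\<^esup>\<close> have degree at most \<open>p + 1\<close>, so beyond that order only \<open>f\<close> contributes.
\<close>

lemma jet_above_degree: "p + 2 < n \<Longrightarrow> jet n P as = (deriv ^^ n) f (P $ Y) * y_product as"
proof -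
  assume "p + 2 < n"
  then have "y_jet n P = (deriv ^^ n) f (P $ Y)" and "z_jet (n - 1) P = (\<lambda>_. 0)"
    by (auto simp: y_jet_def z_jet_def power_deriv_eq_0 fun_eq_iff)
  moreover have "one_slot_sum (\<lambda>_. 0) as = 0" by (induction as) simp_all
  ultimately show ?thesis by (simp add: jet_def)
qed

text \<open>
  The conditions for \<open>k \<le> p\<close> are met for arbitrary scales, by the choice of the \<open>z\<close>-coordinates. The
  form \<open>dy\<^bsup>k+2\<^esup>\<close> of the orders \<open>k > p\<close> can only be matched through \<open>\<alpha>\<close> and \<open>\<beta>\<close>.
\<close>

lemma k_model_for_of_scales:
  assumes idx: "bij_betw idx {..p} UNIV" and m: "m \<le> p + 2"
    and scales: "\<And>P :: real ^ 'i coord. \<exists>\<alpha> \<beta>. \<alpha> \<noteq> 0 \<and> \<beta> \<noteq> 0 \<and>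
      (\<forall>k\<le>m. p < k \<longrightarrow> \<alpha>\<^sup>2 * \<beta> ^ (k + 2) = (deriv ^^ (k + 2)) f (P $ Y))"
  shows "k_model_for m flat_form (model_tensor p idx) g"
  unfolding k_model_for_def
proof (intro conjI allI k_model_model_tensor)
  fix P :: "real ^ 'i coord"
  obtain \<alpha> \<beta> where ab: "\<alpha> \<noteq> 0" "\<beta> \<noteq> 0"
    and top: "\<forall>k\<le>m. p < k \<longrightarrow> \<alpha>\<^sup>2 * \<beta> ^ (k + 2) = (deriv ^^ (k + 2)) f (P $ Y)"
    using scales[of P] by (elim exE conjE)
  obtain \<phi> where \<phi>: "linear \<phi>" "bij \<phi>" "\<And>u v. flat_form (\<phi> u) (\<phi> v) = g P u v"
    "\<And>u. \<phi> u $ X = \<alpha> * u $ X" "\<And>u. \<phi> u $ Y = \<beta> * u $ Y"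
    "\<And>u k. k \<le> p \<Longrightarrow> \<phi> u $ Z (idx k) =
      (y_jet (k + 2) P / (k + 2) * u $ Y + z_jet (k + 1) P u) / (\<alpha>\<^sup>2 * \<beta> ^ (k + 1))"
    by (rule normalising_isometry[OF idx ab, where P = P]) (rule that)
  have slot: "\<alpha>\<^sup>2 * slot_form p idx k (map \<phi> as) = jet (k + 2) P as"
    if k: "k \<le> m" and as: "length as = 2 + k" for k as
  proof (cases "k \<le> p")
    case True
    let ?s = "\<alpha>\<^sup>2 * \<beta> ^ (k + 1)" and ?l = "\<lambda>a :: real ^ 'i coord. a $ Z (idx k)"
    have s: "?s \<noteq> 0" using ab by simp
    have "one_slot_sum (\<lambda>a. ?l (\<phi> a)) as =
        one_slot_sum (\<lambda>a. (a $ Y * (y_jet (k + 2) P / (k + 2)) + z_jet (k + 1) P a) * (1 / ?s)) as"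
      by (simp add: \<phi>(6)[OF True] mult.commute)
    also have "\<dots> = jet (k + 2) P as / ?s"
      unfolding one_slot_sum_mult_right one_slot_sum_add one_slot_sum_y as
      by (simp add: jet_def divide_simps)
    finally have "\<beta> * one_slot_sum ?l (map \<phi> as) = \<beta> ^ (2 + k) * (jet (k + 2) P as / ?s)"
      unfolding one_slot_sum_map[of \<phi> \<beta> ?l, OF \<phi>(5)] as by simp
    then have "\<alpha>\<^sup>2 * \<beta> * one_slot_sum ?l (map \<phi> as) = \<beta> * jet (k + 2) P as"
      using ab by (simp add: field_simps)
    then show ?thesis
      using ab True by (simp add: slot_form_def)
  next
    case False
    then have "\<alpha>\<^sup>2 * \<beta> ^ (k + 2) = (deriv ^^ (k + 2)) f (P $ Y)" using top k by simp
    with False as show ?thesis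
      using jet_above_degree[of "k + 2" P as]
      by (simp add: slot_form_def y_product_map[of \<phi> \<beta>, OF \<phi>(5)] add.commute)
  qed
  have "model_tensor p idx k (map \<phi> vs) = nabla_curvature g k P vs"
    if "k \<le> m" "length vs = 4 + k" for k vs
  proof -
    have "model_tensor p idx k (map \<phi> vs) = kulkarni_nomizu (slot_form p idx k) (map \<phi> vs)"
      using that m by (intro model_tensor_eq) auto
    also have "\<dots> = kulkarni_nomizu (jet (k + 2) P) vs"
      by (rule kulkarni_nomizu_pullback[where \<phi> = \<phi> and k = k, OF \<phi>(4)])
        (use slot that in auto)
    finally show ?thesis using nabla_curvature_eq[OF that(2)] by simp
  qed
  with \<phi>(1,2,3) show "\<exists>\<phi>. linear \<phi> \<and> bij \<phi> \<and> (\<forall>u v. flat_form (\<phi> u) (\<phi> v) = g P u v) \<and>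
      (\<forall>i\<le>m. \<forall>vs. length vs = 4 + i \<longrightarrow> model_tensor p idx i (map \<phi> vs) = nabla_curvature g i P vs)"
    by blast
qed

end

section \<open>Completeness, the exponential map and the models\<close>

theorem theorem1p2:
  fixes p :: nat and f :: "real \<Rightarrow> real" and idx :: "nat \<Rightarrow> 'i::finite"
  assumes "bij_betw idx {..p} UNIV"
    and "smooth_map f"
  shows "geodesically_complete (neutral_metric p f idx) \<and>
    (\<forall>P. exp_is_diffeomorphism (neutral_metric p f idx) P) \<and>
    k_model_for p flat_form (model_tensor p idx) (neutral_metric p f idx) \<and>
    ((\<forall>y. (deriv ^^ (p + 3)) f y > 0) \<and> (\<forall>y. (deriv ^^ (p + 4)) f y > 0) \<longrightarrow>
      k_model_for (p + 2) flat_form (model_tensor p idx) (neutral_metric p f idx))"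
proof (intro conjI allI impI)
  interpret potential_family p f idx
    by unfold_locales (rule assms(2))
  show "geodesically_complete (neutral_metric p f idx)" by (rule metric_complete)
  show "exp_is_diffeomorphism (neutral_metric p f idx) P" for P by (rule metric_exp_diffeomorphism)
  show "k_model_for p flat_form (model_tensor p idx) (neutral_metric p f idx)"
    by (rule k_model_for_of_scales[OF assms(1)]) (auto intro: exI[of _ 1])
  assume pos: "(\<forall>y. (deriv ^^ (p + 3)) f y > 0) \<and> (\<forall>y. (deriv ^^ (p + 4)) f y > 0)"
  show "k_model_for (p + 2) flat_form (model_tensor p idx) (neutral_metric p f idx)"
  proof (rule k_model_for_of_scales[OF assms(1) order_refl])
    fix P :: "real ^ 'i coord"
    define q where "q = (deriv ^^ (p + 3)) f (P $ Y)"
    define r where "r = (deriv ^^ (p + 4)) f (P $ Y)"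
    \<comment> \<open>The quotient of the two scale equations determines \<open>\<beta>\<close>; then the first determines \<open>\<alpha>\<^sup>2\<close>.\<close>
    define \<beta> where "\<beta> = r / q"
    define \<alpha> where "\<alpha> = sqrt (q / \<beta> ^ (p + 3))"
    have qr: "q > 0" "r > 0" using pos by (simp_all add: q_def r_def)
    then have \<beta>: "\<beta> > 0" by (simp add: \<beta>_def)
    with qr have \<alpha>: "\<alpha> > 0" "\<alpha>\<^sup>2 = q / \<beta> ^ (p + 3)" by (simp_all add: \<alpha>_def)
    have 1: "\<alpha>\<^sup>2 * \<beta> ^ (p + 3) = q" using \<alpha> \<beta> by simp
    have 2: "\<alpha>\<^sup>2 * \<beta> ^ (p + 4) = r"
    proof -
      have "\<alpha>\<^sup>2 * \<beta> ^ (p + 4) = \<alpha>\<^sup>2 * \<beta> ^ (p + 3) * \<beta>" by (simp add: numeral_eq_Suc)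
      also have "\<dots> = r" unfolding 1 using qr by (simp add: \<beta>_def)
      finally show ?thesis .
    qed
    have "\<alpha>\<^sup>2 * \<beta> ^ (k + 2) = (deriv ^^ (k + 2)) f (P $ Y)" if "k \<le> p + 2" "p < k" for k
    proof -
      have "k + 2 = p + 3 \<or> k + 2 = p + 4" using that by linarith
      then show ?thesis using 1 2 by (elim disjE) (simp_all only: q_def r_def)
    qed
    then show "\<exists>\<alpha> \<beta>. \<alpha> \<noteq> 0 \<and> \<beta> \<noteq> 0 \<and>
        (\<forall>k\<le>p + 2. p < k \<longrightarrow> \<alpha>\<^sup>2 * \<beta> ^ (k + 2) = (deriv ^^ (k + 2)) f (P $ Y))"
      using \<alpha>(1) \<beta> by (intro exI[of _ \<alpha>] exI[of _ \<beta>]) auto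
  qed
qed

end
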